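(* Let $R$ be an integral domain and let $(K,w)$ be a weighted simplicial complex with $K$ finite and $w:K\to R$. Let $\sigma^{(n)}$ be a maximal face of $K$ (an $n$-simplex not properly contained in any simplex of $K$) with $w(\sigma)\ne 0$, and let $L=K\setminus\{\sigma\}$. Then: (1) $H_k(L,w)\cong H_k(K,w)$ for $k\notin\{n-1,n\}$. (2) $H_{n-1}(K,w)\cong H_{n-1}(L,w)/\{r[\partial^w\sigma]\mid r\in R\}$, where $\partial^w$ denotes the weighted boundary operator of $C_*(K,w)$ and $[\partial^w\sigma]$ denotes the homology class in $H_{n-1}(L,w)$. (3) Let $i_*:H_n(L,w)\to H_n(K,w)$ be the map induced by the inclusion $i:C_*(L,w)\to C_*(K,w)$. Then $$H_n(K,w)/\operatorname{Im}(i_* )\cong\{r\in R\mid r[\partial^w\sigma]=0 \text{ in } H_{n-1}(L,w)\}.$$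
   Context: $R$ is an integral domain (commutative, with unity). Simplicial complexes are finite abstract simplicial complexes (simplices are nonempty finite sets of vertices); $\sigma^{(n)}$ indicates that $\dim\sigma=n$. A weighted simplicial complex (WSC) is a pair $(K,w)$ of a simplicial complex $K$ and a function $w:K\to R$ such that $\sigma_1\subseteq\sigma_2$ implies $w(\sigma_1)\mid w(\sigma_2)$ in $R$. $C_n(K,w)$ is the free $R$-module with basis the $n$-simplices of $K$ with nonzero weight ($C_{k}=0$ for $k<0$). Fixing a total order on the vertices, the weighted boundary map $\partial_n^w:C_n(K,w)\to C_{n-1}(K,w)$ is the $R$-linear map with $\partial_n^w(\sigma)=\sum_{i=0}^n\frac{w(\sigma)}{w(d_i\sigma)}(-1)^i d_i\sigma$, where $d_i[v_0,\dots,v_n]=[v_0,\dots,\widehat{v_i},\dots,v_n]$ (and $\partial_0^w=0$). The weighted homology is the $R$-module $H_n(K,w)=\ker(\partial_n^w)/\operatorname{Im}(\partial_{n+1}^w)$. For a subcomplex $L\subseteq K$, $(L,w)$ means $(L,w|_L)$. All isomorphisms are of $R$-modules. *)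

theory Defs
  imports "HOL-Algebra.Module" "HOL-Algebra.AbelCoset" "HOL-Algebra.Divisibility"
begin

section \<open>Module homomorphisms and quotient modules\<close>

definition module_hom_set ::
    "('r, 'c) ring_scheme \<Rightarrow> ('r, 'm, 'd) module_scheme \<Rightarrow> ('r, 'n, 'e) module_scheme \<Rightarrow> ('m \<Rightarrow> 'n) set"
  where "module_hom_set R M N =
    {h \<in> carrier M \<rightarrow> carrier N.
      (\<forall>x\<in>carrier M. \<forall>y\<in>carrier M. h (x \<oplus>\<^bsub>M\<^esub> y) = h x \<oplus>\<^bsub>N\<^esub> h y) \<and>
      (\<forall>r\<in>carrier R. \<forall>x\<in>carrier M. h (r \<odot>\<^bsub>M\<^esub> x) = r \<odot>\<^bsub>N\<^esub> h x)}"

definition modules_isomorphic ::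
    "('r, 'c) ring_scheme \<Rightarrow> ('r, 'm, 'd) module_scheme \<Rightarrow> ('r, 'n, 'e) module_scheme \<Rightarrow> bool"
  where "modules_isomorphic R M N \<longleftrightarrow>
    module R M \<and> module R N \<and>
    (\<exists>h\<in>module_hom_set R M N. bij_betw h (carrier M) (carrier N))"

text \<open>
  The library's \<^const>\<open>module\<close> locale does not use the fields \<open>mult\<close> and \<open>one\<close> of a module
  record; they are left undefined here and in the chain modules. The union in \<open>smult\<close> is over all
  representatives \<open>x\<close> of the coset \<open>A\<close>, so that \<open>r (x + N) = r x + N\<close>.
\<close>

definition quotient_module :: "('r, 'm, 'd) module_scheme \<Rightarrow> 'm set \<Rightarrow> ('r, 'm set) module"
  where "quotient_module M N =
    \<lparr>carrier = a_rcosets\<^bsub>M\<^esub> N, monoid.mult = undefined, one = undefined,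
     zero = N, add = set_add M,
     smult = (\<lambda>r A. \<Union>x\<in>A. N +>\<^bsub>M\<^esub> (r \<odot>\<^bsub>M\<^esub> x))\<rparr>"

definition ring_as_module :: "('r, 'c) ring_scheme \<Rightarrow> ('r, 'r) module"
  where "ring_as_module R =
    \<lparr>carrier = carrier R, monoid.mult = monoid.mult R, one = one R,
     zero = zero R, add = add R, smult = monoid.mult R\<rparr>"


section \<open>Weighted simplicial complexes\<close>

definition finite_simplicial_complex :: "'a set set \<Rightarrow> bool"
  where "finite_simplicial_complex K \<longleftrightarrow>
    finite K \<and> (\<forall>\<sigma>\<in>K. finite \<sigma> \<and> \<sigma> \<noteq> {}) \<and>
    (\<forall>\<sigma>\<in>K. \<forall>\<tau>. \<tau> \<noteq> {} \<and> \<tau> \<subseteq> \<sigma> \<longrightarrow> \<tau> \<in> K)"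

definition simplex_dim :: "'a set \<Rightarrow> int"
  where "simplex_dim \<sigma> = int (card \<sigma>) - 1"

definition maximal_face :: "'a set set \<Rightarrow> 'a set \<Rightarrow> bool"
  where "maximal_face K \<sigma> \<longleftrightarrow> \<sigma> \<in> K \<and> \<not> (\<exists>\<tau>\<in>K. \<sigma> \<subset> \<tau>)"

definition weighted_simplicial_complex ::
    "('r, 'c) ring_scheme \<Rightarrow> 'a set set \<Rightarrow> ('a set \<Rightarrow> 'r) \<Rightarrow> bool"
  where "weighted_simplicial_complex R K w \<longleftrightarrow>
    finite_simplicial_complex K \<and> w \<in> K \<rightarrow> carrier R \<and>
    (\<forall>\<sigma>\<in>K. \<forall>\<tau>\<in>K. \<sigma> \<subseteq> \<tau> \<longrightarrow> w \<sigma> divides\<^bsub>R\<^esub> w \<tau>)"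


section \<open>The weighted chain complex\<close>

text \<open>
  The degree \<open>n\<close> is an integer. For \<open>n < 0\<close> there are no \<open>n\<close>-simplices, as simplices are
  nonempty, and hence the chain module is zero. The weight \<open>w\<close> is only inspected on \<open>K\<close>, so
  for a subcomplex \<open>L\<close> the restriction of \<open>w\<close> to \<open>L\<close> may be written \<open>w\<close>.
\<close>

definition weighted_simplices ::
    "('r, 'c) ring_scheme \<Rightarrow> 'a set set \<Rightarrow> ('a set \<Rightarrow> 'r) \<Rightarrow> int \<Rightarrow> 'a set set"
  where "weighted_simplices R K w n = {\<sigma> \<in> K. simplex_dim \<sigma> = n \<and> w \<sigma> \<noteq> \<zero>\<^bsub>R\<^esub>}"

text \<open>
  A chain is represented by its coefficient function, which vanishes off the basis. Since \<open>K\<close>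
  is finite, these functions form the free module on the basis. For a subcomplex \<open>L\<close> of \<open>K\<close>
  the inclusion of the chains of \<open>L\<close> into those of \<open>K\<close> is then the identity on functions.
\<close>

definition chain_module ::
    "('r, 'c) ring_scheme \<Rightarrow> 'a set set \<Rightarrow> ('a set \<Rightarrow> 'r) \<Rightarrow> int \<Rightarrow> ('r, 'a set \<Rightarrow> 'r) module"
  where "chain_module R K w n =
    \<lparr>carrier = {c. (\<forall>\<sigma>. c \<sigma> \<in> carrier R) \<and> {\<sigma>. c \<sigma> \<noteq> \<zero>\<^bsub>R\<^esub>} \<subseteq> weighted_simplices R K w n},
     monoid.mult = undefined, one = undefined,
     zero = (\<lambda>\<sigma>. \<zero>\<^bsub>R\<^esub>), add = (\<lambda>c d \<sigma>. c \<sigma> \<oplus>\<^bsub>R\<^esub> d \<sigma>),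
     smult = (\<lambda>r c \<sigma>. r \<otimes>\<^bsub>R\<^esub> c \<sigma>)\<rparr>"

definition basis_chain :: "('r, 'c) ring_scheme \<Rightarrow> 'a set \<Rightarrow> 'a set \<Rightarrow> 'r"
  where "basis_chain R \<sigma> = (\<lambda>\<tau>. if \<tau> = \<sigma> then \<one>\<^bsub>R\<^esub> else \<zero>\<^bsub>R\<^esub>)"

text \<open>
  The quotient \<open>a / b\<close> in an integral domain, for \<open>b\<close> nonzero and dividing \<open>a\<close>.
\<close>

definition exact_quotient :: "('r, 'c) ring_scheme \<Rightarrow> 'r \<Rightarrow> 'r \<Rightarrow> 'r"
  where "exact_quotient R a b = (THE c. c \<in> carrier R \<and> a = b \<otimes>\<^bsub>R\<^esub> c)"

definition simplex_face :: "nat \<Rightarrow> 'a::linorder set \<Rightarrow> 'a set"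
  where "simplex_face i \<sigma> = \<sigma> - {sorted_list_of_set \<sigma> ! i}"

definition weighted_boundary_simplex ::
    "('r, 'c) ring_scheme \<Rightarrow> 'a::linorder set set \<Rightarrow> ('a set \<Rightarrow> 'r) \<Rightarrow> int \<Rightarrow> 'a set \<Rightarrow> 'a set \<Rightarrow> 'r"
  where "weighted_boundary_simplex R K w n \<sigma> =
    (\<Oplus>\<^bsub>chain_module R K w (n - 1)\<^esub>i\<in>{0..nat n}.
       (exact_quotient R (w \<sigma>) (w (simplex_face i \<sigma>)) \<otimes>\<^bsub>R\<^esub> (\<ominus>\<^bsub>R\<^esub> \<one>\<^bsub>R\<^esub>) [^]\<^bsub>R\<^esub> i)
         \<odot>\<^bsub>chain_module R K w (n - 1)\<^esub> basis_chain R (simplex_face i \<sigma>))"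

definition weighted_boundary ::
    "('r, 'c) ring_scheme \<Rightarrow> 'a::linorder set set \<Rightarrow> ('a set \<Rightarrow> 'r) \<Rightarrow> int \<Rightarrow>
      ('a set \<Rightarrow> 'r) \<Rightarrow> 'a set \<Rightarrow> 'r"
  where "weighted_boundary R K w n c =
    (if n \<le> 0 then \<zero>\<^bsub>chain_module R K w (n - 1)\<^esub>
     else \<Oplus>\<^bsub>chain_module R K w (n - 1)\<^esub>\<sigma>\<in>weighted_simplices R K w n.
       c \<sigma> \<odot>\<^bsub>chain_module R K w (n - 1)\<^esub> weighted_boundary_simplex R K w n \<sigma>)"


section \<open>Weighted homology\<close>

definition cycle_module ::
    "('r, 'c) ring_scheme \<Rightarrow> 'a::linorder set set \<Rightarrow> ('a set \<Rightarrow> 'r) \<Rightarrow> int \<Rightarrow> ('r, 'a set \<Rightarrow> 'r) module"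
  where "cycle_module R K w n = (chain_module R K w n)
    \<lparr>carrier := a_kernel (chain_module R K w n) (chain_module R K w (n - 1))
                  (weighted_boundary R K w n)\<rparr>"

definition boundary_set ::
    "('r, 'c) ring_scheme \<Rightarrow> 'a::linorder set set \<Rightarrow> ('a set \<Rightarrow> 'r) \<Rightarrow> int \<Rightarrow> ('a set \<Rightarrow> 'r) set"
  where "boundary_set R K w n =
    weighted_boundary R K w (n + 1) ` carrier (chain_module R K w (n + 1))"

definition weighted_homology ::
    "('r, 'c) ring_scheme \<Rightarrow> 'a::linorder set set \<Rightarrow> ('a set \<Rightarrow> 'r) \<Rightarrow> int \<Rightarrow>
      ('r, ('a set \<Rightarrow> 'r) set) module"
  where "weighted_homology R K w n =
    quotient_module (cycle_module R K w n) (boundary_set R K w n)"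

definition homology_class ::
    "('r, 'c) ring_scheme \<Rightarrow> 'a::linorder set set \<Rightarrow> ('a set \<Rightarrow> 'r) \<Rightarrow> int \<Rightarrow>
      ('a set \<Rightarrow> 'r) \<Rightarrow> ('a set \<Rightarrow> 'r) set"
  where "homology_class R K w n z = boundary_set R K w n +>\<^bsub>cycle_module R K w n\<^esub> z"

text \<open>
  The map induced in degree \<open>n\<close> homology, with values in the homology of \<open>(K, w)\<close>, by a chain
  map that is \<open>f\<close> in degree \<open>n\<close>. It sends the class of \<open>z\<close> to the class of \<open>f z\<close>; the classes
  of \<open>f z\<close> coincide for all representatives \<open>z\<close> of a class \<open>A\<close>.
\<close>

definition induced_homology_map ::
    "('r, 'c) ring_scheme \<Rightarrow> 'a::linorder set set \<Rightarrow> ('a set \<Rightarrow> 'r) \<Rightarrow> int \<Rightarrow>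
      (('a set \<Rightarrow> 'r) \<Rightarrow> ('a set \<Rightarrow> 'r)) \<Rightarrow> ('a set \<Rightarrow> 'r) set \<Rightarrow> ('a set \<Rightarrow> 'r) set"
  where "induced_homology_map R K w n f A = (\<Union>z\<in>A. homology_class R K w n (f z))"

end

theory Submission
  imports Defs
begin

text \<open>
  Since \<open>\<sigma>\<close> is maximal, every chain \<open>c\<close> of \<open>K\<close> in degree \<open>n\<close> is \<open>c' + c(\<sigma>) \<sigma>\<close> with \<open>c'\<close> a chain of \<open>L\<close>,
  and the two complexes agree in all other degrees. So the cycles and boundaries of \<open>K\<close> and \<open>L\<close>
  differ only by \<open>B\<^sub>n\<^sub>-\<^sub>1(K) = B\<^sub>n\<^sub>-\<^sub>1(L) + R \<partial>\<sigma>\<close> and \<open>Z\<^sub>n(L) = {c \<in> Z\<^sub>n(K). c(\<sigma>) = 0}\<close>. The isomorphism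
  theorem \<open>Z/P \<cong> (Z/B)/(P/B)\<close> with \<open>P = B\<^sub>n\<^sub>-\<^sub>1(K)\<close> gives the statement on degree \<open>n - 1\<close>; with
  \<open>P = Z\<^sub>n(L)\<close> it reduces the one on degree \<open>n\<close> to evaluating cycles at \<open>\<sigma>\<close>, where \<open>r\<close> is a value
  iff \<open>r \<partial>\<sigma>\<close> bounds in \<open>L\<close>.
\<close>

section \<open>Isomorphism theorems for modules\<close>

lemma (in module) submodule_abelian_subgroup:
  assumes "submodule N R M"
  shows "abelian_subgroup N M"
  by (meson abelian_group_axioms abelian_subgroupI3 additive_subgroupI assms submodule.axioms(1))

lemma quotient_module_sel:
  "carrier (quotient_module M N) = a_rcosets\<^bsub>M\<^esub> N"
  "zero (quotient_module M N) = N"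
  "add (quotient_module M N) = set_add M"
  by (simp_all add: quotient_module_def)

section \<open>Quotient modules computed on coset representatives\<close>

context module
begin

context
  fixes N
  assumes N: "submodule N R M"
begin

interpretation N: abelian_subgroup N M
  by (rule submodule_abelian_subgroup [OF N])

lemma quotient_carrier: "carrier (quotient_module M N) = (\<lambda>x. N +>\<^bsub>M\<^esub> x) ` carrier M"
  by (auto simp: quotient_module_sel A_RCOSETS_def')

lemma coset_in_quotient: "x \<in> carrier M \<Longrightarrow> N +>\<^bsub>M\<^esub> x \<in> carrier (quotient_module M N)"
  by (auto simp: quotient_module_sel A_RCOSETS_def')

lemma quotient_add:
  "\<lbrakk>x \<in> carrier M; y \<in> carrier M\<rbrakk> \<Longrightarrow>
    (N +>\<^bsub>M\<^esub> x) \<oplus>\<^bsub>quotient_module M N\<^esub> (N +>\<^bsub>M\<^esub> y) = N +>\<^bsub>M\<^esub> (x \<oplus>\<^bsub>M\<^esub> y)"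
  by (simp add: quotient_module_sel N.a_rcos_sum)

lemma coset_eq_iff:
  assumes "x \<in> carrier M" "y \<in> carrier M"
  shows "N +>\<^bsub>M\<^esub> x = N +>\<^bsub>M\<^esub> y \<longleftrightarrow> x \<ominus>\<^bsub>M\<^esub> y \<in> N"
proof -
  have "N +>\<^bsub>M\<^esub> x = N +>\<^bsub>M\<^esub> y \<longleftrightarrow> x \<in> N +>\<^bsub>M\<^esub> y"
    using N.a_repr_independence'[of x y] N.a_rcos_self[of x] assms by auto
  also have "\<dots> \<longleftrightarrow> x \<ominus>\<^bsub>M\<^esub> y \<in> N"
    using N.a_rcos_module[of y x] assms M.abelian_group_axioms by (simp add: M.minus_eq)
  finally show ?thesis .
qed

lemma coset_eq_self_iff: "x \<in> carrier M \<Longrightarrow> N +>\<^bsub>M\<^esub> x = N \<longleftrightarrow> x \<in> N"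
  using M.a_coset_join2[of x N] N.a_rcos_self[of x] N.a_subgroup by auto

text \<open>The union over representatives in \<open>smult\<close> collapses to one coset: replacing
  \<open>x\<close> by \<open>b + x\<close> with \<open>b\<close> in \<open>N\<close> changes the
  multiple by \<open>r b\<close>, which is again in \<open>N\<close>.\<close>

lemma quotient_smult:
  assumes r: "r \<in> carrier R" and x: "x \<in> carrier M"
  shows "r \<odot>\<^bsub>quotient_module M N\<^esub> (N +>\<^bsub>M\<^esub> x) = N +>\<^bsub>M\<^esub> (r \<odot>\<^bsub>M\<^esub> x)"
proof -
  have "N +>\<^bsub>M\<^esub> (r \<odot>\<^bsub>M\<^esub> y) = N +>\<^bsub>M\<^esub> (r \<odot>\<^bsub>M\<^esub> x)" if y: "y \<in> N +>\<^bsub>M\<^esub> x" for y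
  proof -
    from y obtain b where b: "b \<in> N" "y = b \<oplus>\<^bsub>M\<^esub> x"
      by (auto simp: a_r_coset_def')
    have "r \<odot>\<^bsub>M\<^esub> y = r \<odot>\<^bsub>M\<^esub> b \<oplus>\<^bsub>M\<^esub> r \<odot>\<^bsub>M\<^esub> x"
      using b x r by (simp add: smult_r_distr)
    moreover have "r \<odot>\<^bsub>M\<^esub> b \<in> N"
      using submodule.smult_closed[OF N] b r by simp
    ultimately have "r \<odot>\<^bsub>M\<^esub> y \<in> N +>\<^bsub>M\<^esub> (r \<odot>\<^bsub>M\<^esub> x)"
      by (auto simp: a_r_coset_def')
    then show ?thesis
      using N.a_repr_independence'[of "r \<odot>\<^bsub>M\<^esub> y" "r \<odot>\<^bsub>M\<^esub> x"] r x by simp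
  qed
  then have "(\<Union>y\<in>N +>\<^bsub>M\<^esub> x. N +>\<^bsub>M\<^esub> (r \<odot>\<^bsub>M\<^esub> y)) = N +>\<^bsub>M\<^esub> (r \<odot>\<^bsub>M\<^esub> x)"
    using N.a_rcos_self[OF x] by blast
  then show ?thesis
    by (simp add: quotient_module_def)
qed

lemma quotient_module_is_module: "module R (quotient_module M N)"
proof (rule moduleI)
  show "cring R" by (rule cring_axioms)
  show "abelian_group (quotient_module M N)"
  proof (rule abelian_groupI)
    let ?Q = "quotient_module M N"
    \<comment> \<open>The zero of the quotient is the set \<open>N\<close> itself. As the coset of
      zero it becomes accessible to \<open>quotient_add\<close>.\<close>
    have zero: "\<zero>\<^bsub>?Q\<^esub> = N +>\<^bsub>M\<^esub> \<zero>\<^bsub>M\<^esub>"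
      using coset_eq_self_iff[of "\<zero>\<^bsub>M\<^esub>"] by (simp add: quotient_module_sel)
    show "\<zero>\<^bsub>?Q\<^esub> \<in> carrier ?Q"
      unfolding zero by (simp add: coset_in_quotient)
    show "x \<oplus>\<^bsub>?Q\<^esub> y \<in> carrier ?Q" if "x \<in> carrier ?Q" "y \<in> carrier ?Q" for x y
      using that unfolding quotient_carrier by (auto simp: quotient_add)
    show "x \<oplus>\<^bsub>?Q\<^esub> y \<oplus>\<^bsub>?Q\<^esub> z = x \<oplus>\<^bsub>?Q\<^esub> (y \<oplus>\<^bsub>?Q\<^esub> z)"
      if "x \<in> carrier ?Q" "y \<in> carrier ?Q" "z \<in> carrier ?Q" for x y z
      using that unfolding quotient_carrier by (auto simp: quotient_add M.a_assoc)
    show "x \<oplus>\<^bsub>?Q\<^esub> y = y \<oplus>\<^bsub>?Q\<^esub> x" if "x \<in> carrier ?Q" "y \<in> carrier ?Q" for x y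
      using that unfolding quotient_carrier by (auto simp: quotient_add M.a_comm)
    show "\<zero>\<^bsub>?Q\<^esub> \<oplus>\<^bsub>?Q\<^esub> x = x" if "x \<in> carrier ?Q" for x
      using that unfolding quotient_carrier zero by (auto simp: quotient_add)
    show "\<exists>y\<in>carrier ?Q. y \<oplus>\<^bsub>?Q\<^esub> x = \<zero>\<^bsub>?Q\<^esub>" if "x \<in> carrier ?Q" for x
    proof -
      obtain a where "a \<in> carrier M" "x = N +>\<^bsub>M\<^esub> a"
        using \<open>x \<in> carrier ?Q\<close> unfolding quotient_carrier by auto
      then show ?thesis
        by (intro bexI[of _ "N +>\<^bsub>M\<^esub> (\<ominus>\<^bsub>M\<^esub> a)"])
          (simp_all add: zero quotient_add coset_in_quotient M.l_neg)
    qed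
  qed
next
  show "a \<odot>\<^bsub>quotient_module M N\<^esub> x \<in> carrier (quotient_module M N)"
    if "a \<in> carrier R" "x \<in> carrier (quotient_module M N)" for a x
    using that coset_in_quotient unfolding quotient_carrier by (auto simp: quotient_smult)
  show "(a \<oplus> b) \<odot>\<^bsub>quotient_module M N\<^esub> x =
      (a \<odot>\<^bsub>quotient_module M N\<^esub> x) \<oplus>\<^bsub>quotient_module M N\<^esub> (b \<odot>\<^bsub>quotient_module M N\<^esub> x)"
    if ab: "a \<in> carrier R" "b \<in> carrier R" and x: "x \<in> carrier (quotient_module M N)" for a b x
  proof -
    obtain u where "u \<in> carrier M" "x = N +>\<^bsub>M\<^esub> u"
      using x unfolding quotient_carrier by auto
    then show ?thesis
      using ab quotient_add[of "a \<odot>\<^bsub>M\<^esub> u" "b \<odot>\<^bsub>M\<^esub> u"]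
      by (simp only: quotient_smult smult_l_distr smult_closed R.add.m_closed)
  qed
  show "a \<odot>\<^bsub>quotient_module M N\<^esub> (x \<oplus>\<^bsub>quotient_module M N\<^esub> y) =
      (a \<odot>\<^bsub>quotient_module M N\<^esub> x) \<oplus>\<^bsub>quotient_module M N\<^esub> (a \<odot>\<^bsub>quotient_module M N\<^esub> y)"
    if "a \<in> carrier R" "x \<in> carrier (quotient_module M N)" "y \<in> carrier (quotient_module M N)" for a x y
    using that unfolding quotient_carrier
    by (auto simp: quotient_smult quotient_add smult_r_distr)
  show "(a \<otimes> b) \<odot>\<^bsub>quotient_module M N\<^esub> x =
      a \<odot>\<^bsub>quotient_module M N\<^esub> (b \<odot>\<^bsub>quotient_module M N\<^esub> x)"
    if "a \<in> carrier R" "b \<in> carrier R" "x \<in> carrier (quotient_module M N)" for a b x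
    using that unfolding quotient_carrier by (auto simp: quotient_smult smult_assoc1)
  show "\<one> \<odot>\<^bsub>quotient_module M N\<^esub> x = x"
    if "x \<in> carrier (quotient_module M N)" for x
    using that unfolding quotient_carrier by (auto simp: quotient_smult)
qed

lemma coset_hom: "(\<lambda>x. N +>\<^bsub>M\<^esub> x) \<in> module_hom_set R M (quotient_module M N)"
  unfolding module_hom_set_def
  using coset_in_quotient quotient_add quotient_smult by auto

end

end

section \<open>Homomorphisms, isomorphisms and the isomorphism theorems\<close>

lemma module_hom_setD:
  assumes "h \<in> module_hom_set R M N"
  shows "x \<in> carrier M \<Longrightarrow> h x \<in> carrier N"
    and "\<lbrakk>x \<in> carrier M; y \<in> carrier M\<rbrakk> \<Longrightarrow> h (x \<oplus>\<^bsub>M\<^esub> y) = h x \<oplus>\<^bsub>N\<^esub> h y"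
    and "\<lbrakk>r \<in> carrier R; x \<in> carrier M\<rbrakk> \<Longrightarrow> h (r \<odot>\<^bsub>M\<^esub> x) = r \<odot>\<^bsub>N\<^esub> h x"
  using assms by (auto simp: module_hom_set_def)

lemma module_hom_set_compose:
  assumes "f \<in> module_hom_set R M N" "g \<in> module_hom_set R N P"
  shows "(\<lambda>x. g (f x)) \<in> module_hom_set R M P"
  using assms by (auto simp: module_hom_set_def Pi_iff)

lemma module_hom_abelian_group_hom:
  assumes "module R M" "module R N" "h \<in> module_hom_set R M N"
  shows "abelian_group_hom M N h"
proof (rule abelian_group_homI)
  show "abelian_group M" "abelian_group N"
    using assms by (auto simp: module_def)
  then show "group_hom (add_monoid M) (add_monoid N) h"
    using module_hom_setD[OF assms(3)]
    by (auto intro!: group_hom.intro group_hom_axioms.intro homI simp: abelian_group.a_group)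
qed

lemma module_hom_image_submodule:
  assumes M: "module R M" and N: "module R N" and h: "h \<in> module_hom_set R M N"
    and P: "submodule P R M"
  shows "submodule (h ` P) R N"
proof -
  interpret M: module R M by fact
  interpret N: module R N by fact
  interpret h: abelian_group_hom M N h by (rule module_hom_abelian_group_hom[OF M N h])
  note PE = M.submoduleE[OF P]
  have PM: "x \<in> carrier M" if "x \<in> P" for x using that PE(1) by auto
  have zero: "\<zero>\<^bsub>M\<^esub> \<in> P"
    using subgroup.one_closed[OF submodule.axioms(1)[OF P]] by simp
  show ?thesis
  proof (intro N.submoduleI)
    show "h ` P \<subseteq> carrier N" using PM by auto
    show "\<zero>\<^bsub>N\<^esub> \<in> h ` P" using zero h.hom_zero by (metis imageI)
    show "\<ominus>\<^bsub>N\<^esub> a \<in> h ` P" if "a \<in> h ` P" for a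
      using that PE(3) PM by (auto simp flip: h.hom_a_inv)
    show "a \<oplus>\<^bsub>N\<^esub> b \<in> h ` P" if "a \<in> h ` P" "b \<in> h ` P" for a b
      using that PE(5) PM by (auto simp flip: h.hom_add)
    show "a \<odot>\<^bsub>N\<^esub> x \<in> h ` P" if "a \<in> carrier R" "x \<in> h ` P" for a x
      using that PE(4) PM by (auto simp flip: module_hom_setD(3)[OF h])
  qed
qed

lemma module_hom_kernel_submodule:
  assumes M: "module R M" and N: "module R N" and h: "h \<in> module_hom_set R M N"
  shows "submodule (a_kernel M N h) R M"
proof -
  interpret M: module R M by fact
  interpret N: module R N by fact
  interpret h: abelian_group_hom M N h by (rule module_hom_abelian_group_hom[OF M N h])
  show ?thesis
    by (rule M.submoduleI) (auto simp: a_kernel_def' module_hom_setD(3)[OF h])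
qed

lemma modules_isomorphic_refl: "module R M \<Longrightarrow> modules_isomorphic R M M"
  unfolding modules_isomorphic_def module_hom_set_def
  by (auto intro!: exI[of _ id])

lemma modules_isomorphic_sym:
  assumes "modules_isomorphic R M N"
  shows "modules_isomorphic R N M"
proof -
  obtain h where M: "module R M" and N: "module R N" and h: "h \<in> module_hom_set R M N"
    and bij: "bij_betw h (carrier M) (carrier N)"
    using assms by (auto simp: modules_isomorphic_def)
  interpret M: module R M by fact
  define g where "g = inv_into (carrier M) h"
  have gM: "g y \<in> carrier M" and hg: "h (g y) = y" if "y \<in> carrier N" for y
    using that bij unfolding g_def bij_betw_def
    by (auto simp: inv_into_into f_inv_into_f)
  \<comment> \<open>By injectivity of \<open>h\<close>, an identity for \<open>g\<close> may be
    checked after applying \<open>h\<close>; this reduces linearity of the inverse to linearity of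
    \<open>h\<close>.\<close>
  have eqI: "g y = x" if "x \<in> carrier M" "h x = y" for x y
    using that bij unfolding g_def bij_betw_def by auto
  have "g \<in> module_hom_set R N M"
    unfolding module_hom_set_def
    by (auto intro!: eqI simp: gM hg module_hom_setD[OF h])
  moreover have "bij_betw g (carrier N) (carrier M)"
    unfolding g_def by (rule bij_betw_inv_into[OF bij])
  ultimately show ?thesis
    using M N by (auto simp: modules_isomorphic_def)
qed

lemma modules_isomorphic_trans:
  assumes "modules_isomorphic R M N" "modules_isomorphic R N P"
  shows "modules_isomorphic R M P"
proof -
  obtain f g where fg: "f \<in> module_hom_set R M N" "bij_betw f (carrier M) (carrier N)"
      "g \<in> module_hom_set R N P" "bij_betw g (carrier N) (carrier P)"
    and "module R M" "module R P"
    using assms by (auto simp: modules_isomorphic_def)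
  moreover have "bij_betw (\<lambda>x. g (f x)) (carrier M) (carrier P)"
    using bij_betw_trans[OF fg(2,4)] by (simp add: comp_def)
  ultimately show ?thesis
    unfolding modules_isomorphic_def using module_hom_set_compose[OF fg(1,3)] by blast
qed

text \<open>Bijectivity comes from the first isomorphism theorem for the additive groups;
  compatibility with scalars is then checked on representatives.\<close>

theorem module_first_isomorphism:
  assumes M: "module R M" and N: "module R N" and h: "h \<in> module_hom_set R M N"
    and onto: "h ` carrier M = carrier N"
  shows "modules_isomorphic R (quotient_module M (a_kernel M N h)) N"
proof -
  interpret M: module R M by fact
  interpret N: module R N by fact
  interpret h: abelian_group_hom M N h by (rule module_hom_abelian_group_hom[OF M N h])
  define P where "P = a_kernel M N h"
  have P: "submodule P R M"
    unfolding P_def by (rule module_hom_kernel_submodule[OF M N h])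
  have mem_P: "b \<in> P \<longleftrightarrow> b \<in> carrier M \<and> h b = \<zero>\<^bsub>N\<^esub>" for b
    by (simp add: P_def a_kernel_def')
  interpret P: abelian_subgroup P M by (rule M.submodule_abelian_subgroup[OF P])
  \<comment> \<open>\<open>h\<close> is constant on each coset of its kernel, so the image of a
    coset is a singleton and \<open>the_elem\<close> extracts the common value.\<close>
  define g where "g = (\<lambda>X. the_elem (h ` X))"
  have "h y = h x" if x: "x \<in> carrier M" and "y \<in> P +>\<^bsub>M\<^esub> x" for x y
  proof -
    obtain b where "b \<in> P" "y = b \<oplus>\<^bsub>M\<^esub> x"
      using \<open>y \<in> P +>\<^bsub>M\<^esub> x\<close> by (auto simp: a_r_coset_def')
    then show ?thesis
      using x module_hom_setD(1,2)[OF h] by (simp add: mem_P N.l_zero)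
  qed
  then have g: "g (P +>\<^bsub>M\<^esub> x) = h x" if "x \<in> carrier M" for x
    unfolding g_def using P.a_rcos_self[OF that] that by (intro the_elem_image_unique) blast+
  have "g \<in> iso (M A_Mod P) (add_monoid N)"
    unfolding g_def P_def by (rule h.A_FactGroup_iso_set[OF onto])
  then have "bij_betw g (carrier (quotient_module M P)) (carrier N)"
    by (simp add: iso_def A_FactGroup_def' quotient_module_sel)
  moreover have "g \<in> module_hom_set R (quotient_module M P) N"
    unfolding module_hom_set_def M.quotient_carrier[OF P]
    using module_hom_setD[OF h]
    by (auto simp: g M.quotient_add[OF P] M.quotient_smult[OF P])
  ultimately show ?thesis
    unfolding modules_isomorphic_def P_def[symmetric]
    using N M.quotient_module_is_module[OF P] by blast
qed

text \<open>The composite of the two projections, first modulo \<open>B\<close> and then modulo the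
  image of \<open>P\<close>, is onto with kernel \<open>P\<close>, so the first isomorphism theorem
  applies.\<close>

theorem module_third_isomorphism:
  assumes M: "module R M" and B: "submodule B R M" and P: "submodule P R M" and "B \<subseteq> P"
  shows "modules_isomorphic R (quotient_module M P)
    (quotient_module (quotient_module M B) ((\<lambda>x. B +>\<^bsub>M\<^esub> x) ` P))"
proof -
  interpret M: module R M by fact
  let ?Q = "quotient_module M B"
  let ?\<pi> = "\<lambda>x. B +>\<^bsub>M\<^esub> x"
  have Q: "module R ?Q" by (rule M.quotient_module_is_module[OF B])
  interpret Q: module R ?Q by fact
  have S: "submodule (?\<pi> ` P) R ?Q"
    by (rule module_hom_image_submodule[OF M Q M.coset_hom[OF B] P])
  let ?h = "\<lambda>x. ?\<pi> ` P +>\<^bsub>?Q\<^esub> ?\<pi> x"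
  have h: "?h \<in> module_hom_set R M (quotient_module ?Q (?\<pi> ` P))"
    by (rule module_hom_set_compose[OF M.coset_hom[OF B] Q.coset_hom[OF S]])
  have onto: "?h ` carrier M = carrier (quotient_module ?Q (?\<pi> ` P))"
    unfolding Q.quotient_carrier[OF S] M.quotient_carrier[OF B] by auto
  note PE = M.submoduleE[OF P]
  \<comment> \<open>Here \<open>B \<subseteq> P\<close> matters: if \<open>x\<close> is congruent
    modulo \<open>B\<close> to some \<open>p\<close> in \<open>P\<close>, then \<open>x\<close>
    differs from \<open>p\<close> by an element of \<open>P\<close>.\<close>
  have inP: "x \<in> P" if x: "x \<in> carrier M" and eq: "?\<pi> x \<in> ?\<pi> ` P" for x
  proof -
    obtain p where p: "p \<in> P" "?\<pi> x = ?\<pi> p" using eq by auto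
    then have "p \<in> carrier M" using PE(1) by auto
    then have "x \<ominus>\<^bsub>M\<^esub> p \<in> P"
      using M.coset_eq_iff[OF B x] p \<open>B \<subseteq> P\<close> by auto
    then have "(x \<ominus>\<^bsub>M\<^esub> p) \<oplus>\<^bsub>M\<^esub> p \<in> P" using PE(5) p by auto
    then show ?thesis
      using x \<open>p \<in> carrier M\<close> by (simp add: M.minus_eq M.a_assoc M.l_neg)
  qed
  have "a_kernel M (quotient_module ?Q (?\<pi> ` P)) ?h = P"
  proof -
    have "?h x = ?\<pi> ` P \<longleftrightarrow> x \<in> P" if "x \<in> carrier M" for x
      using Q.coset_eq_self_iff[OF S M.coset_in_quotient[OF B that]] inP[OF that] by blast
    then show ?thesis
      using PE(1) unfolding a_kernel_def' quotient_module_sel(2) by blast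
  qed
  then show ?thesis
    using module_first_isomorphism[OF M Q.quotient_module_is_module[OF S] h onto] by simp
qed

lemma module_hom_finsum:
  assumes M: "module R M" and N: "module R N" and h: "h \<in> module_hom_set R M N"
    and f: "f \<in> A \<rightarrow> carrier M"
  shows "h (\<Oplus>\<^bsub>M\<^esub>a\<in>A. f a) = (\<Oplus>\<^bsub>N\<^esub>a\<in>A. h (f a))"
proof -
  interpret M: module R M by fact
  interpret N: module R N by fact
  interpret h: abelian_group_hom M N h by (rule module_hom_abelian_group_hom[OF M N h])
  show ?thesis
    using f
  proof (induction A rule: infinite_finite_induct)
    case (insert x F)
    then have "f x \<in> carrier M" "f \<in> F \<rightarrow> carrier M"
      by auto
    moreover from this have "(\<lambda>a. h (f a)) \<in> F \<rightarrow> carrier N"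
      using module_hom_setD(1)[OF h] by blast
    ultimately show ?case
      using insert by (simp add: M.finsum_insert N.finsum_insert)
  qed auto
qed

section \<open>The weighted chain complex\<close>

text \<open>The cancellation behind \<partial>\<partial> = 0, with \<open>F v u\<close> standing for
  the term in which first \<open>v\<close> and then \<open>u\<close> is removed. A new index
  \<open>x\<close> adds the terms \<open>F x v\<close> and \<open>F v x\<close> for \<open>v\<close>
  in \<open>A\<close>, which cancel in pairs. Induction avoids both an order on the indices and a
  division by two.\<close>

lemma (in abelian_group) finsum_antisymmetric_offdiag:
  assumes "finite A"
    and "\<And>u v. \<lbrakk>u \<in> A; v \<in> A; u \<noteq> v\<rbrakk> \<Longrightarrow> F u v \<in> carrier G"
    and "\<And>u v. \<lbrakk>u \<in> A; v \<in> A; u \<noteq> v\<rbrakk> \<Longrightarrow> F u v \<oplus> F v u = \<zero>"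
  shows "(\<Oplus>v\<in>A. \<Oplus>u\<in>A - {v}. F v u) = \<zero>"
  using assms
proof (induction A rule: finite_induct)
  case (insert x A)
  have F: "F u v \<in> carrier G" if "u \<in> insert x A" "v \<in> insert x A" "u \<noteq> v" for u v
    using insert.prems(1) that by blast
  have [simp]: "F v x \<in> carrier G" "F x v \<in> carrier G" if "v \<in> A" for v
    using F insert.hyps that by auto
  have inner [simp]: "(\<Oplus>u\<in>A - {v}. F v u) \<in> carrier G" if "v \<in> A" for v
    using F that by (intro finsum_closed) auto
  have split: "(\<Oplus>u\<in>insert x A - {v}. F v u) = F v x \<oplus> (\<Oplus>u\<in>A - {v}. F v u)" if "v \<in> A" for v
  proof -
    have "insert x A - {v} = insert x (A - {v})"
      using that insert.hyps by auto
    moreover have "F v \<in> A - {v} \<rightarrow> carrier G"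
      using F that by auto
    ultimately show ?thesis
      using that insert.hyps by (simp add: finsum_insert)
  qed
  have "(\<Oplus>v\<in>A. \<Oplus>u\<in>insert x A - {v}. F v u) = (\<Oplus>v\<in>A. F v x \<oplus> (\<Oplus>u\<in>A - {v}. F v u))"
    by (intro finsum_cong') (auto simp: split)
  also have "\<dots> = (\<Oplus>v\<in>A. F v x) \<oplus> (\<Oplus>v\<in>A. \<Oplus>u\<in>A - {v}. F v u)"
    by (intro finsum_addf) auto
  also have "(\<Oplus>v\<in>A. \<Oplus>u\<in>A - {v}. F v u) = \<zero>"
    using insert.IH insert.prems by auto
  also have "(\<Oplus>v\<in>A. F v x) \<oplus> \<zero> = (\<Oplus>v\<in>A. F v x)"
    by (intro r_zero finsum_closed) auto
  finally have A: "(\<Oplus>v\<in>A. \<Oplus>u\<in>insert x A - {v}. F v u) = (\<Oplus>v\<in>A. F v x)" .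
  have "(\<Oplus>v\<in>insert x A. \<Oplus>u\<in>insert x A - {v}. F v u) =
      (\<Oplus>u\<in>insert x A - {x}. F x u) \<oplus> (\<Oplus>v\<in>A. \<Oplus>u\<in>insert x A - {v}. F v u)"
    using insert.hyps F by (intro finsum_insert) (auto intro!: finsum_closed)
  also have "insert x A - {x} = A"
    using insert.hyps by auto
  also have "(\<Oplus>u\<in>A. F x u) \<oplus> (\<Oplus>v\<in>A. \<Oplus>u\<in>insert x A - {v}. F v u) = (\<Oplus>u\<in>A. F x u \<oplus> F u x)"
    unfolding A by (intro finsum_addf[symmetric]) auto
  also have "\<dots> = (\<Oplus>u\<in>A. \<zero>)"
    using insert by (intro finsum_cong') auto
  finally show ?case by simp
qed simp

section \<open>Chains as coefficient functions\<close>

lemma chain_carrier_iff: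
  "c \<in> carrier (chain_module R K w n) \<longleftrightarrow>
    (\<forall>\<sigma>. c \<sigma> \<in> carrier R) \<and> (\<forall>\<sigma>. \<sigma> \<notin> weighted_simplices R K w n \<longrightarrow> c \<sigma> = \<zero>\<^bsub>R\<^esub>)"
  by (auto simp: chain_module_def)

lemma chain_module_sel [simp]:
  "\<zero>\<^bsub>chain_module R K w n\<^esub> = (\<lambda>\<sigma>. \<zero>\<^bsub>R\<^esub>)"
  "c \<oplus>\<^bsub>chain_module R K w n\<^esub> d = (\<lambda>\<sigma>. c \<sigma> \<oplus>\<^bsub>R\<^esub> d \<sigma>)"
  "r \<odot>\<^bsub>chain_module R K w n\<^esub> c = (\<lambda>\<sigma>. r \<otimes>\<^bsub>R\<^esub> c \<sigma>)"
  by (simp_all add: chain_module_def)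

lemma (in cring) chain_module_is_module: "module R (chain_module R K w n)"
proof (rule moduleI)
  show "cring R" by (rule cring_axioms)
  show "abelian_group (chain_module R K w n)"
  proof (rule abelian_groupI)
    let ?C = "chain_module R K w n"
    show "\<exists>y\<in>carrier ?C. y \<oplus>\<^bsub>?C\<^esub> x = \<zero>\<^bsub>?C\<^esub>" if "x \<in> carrier ?C" for x
      using that by (intro bexI[of _ "\<lambda>\<sigma>. \<ominus> x \<sigma>"]) (auto simp: chain_carrier_iff l_neg)
    show "x \<oplus>\<^bsub>?C\<^esub> y \<oplus>\<^bsub>?C\<^esub> z = x \<oplus>\<^bsub>?C\<^esub> (y \<oplus>\<^bsub>?C\<^esub> z)"
      if "x \<in> carrier ?C" "y \<in> carrier ?C" "z \<in> carrier ?C" for x y z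
      using that by (simp add: chain_carrier_iff a_assoc)
  qed (auto simp: chain_carrier_iff a_comm)
qed (auto simp: chain_carrier_iff l_distr r_distr m_assoc)

text \<open>Sums of chains are pointwise sums in \<open>R\<close>. This allows sums formed in the
  chain modules of different complexes to be compared.\<close>

lemma (in cring) finsum_chain_module:
  assumes "f \<in> A \<rightarrow> carrier (chain_module R K w n)"
  shows "(\<Oplus>\<^bsub>chain_module R K w n\<^esub>a\<in>A. f a) = (\<lambda>\<tau>. \<Oplus>a\<in>A. f a \<tau>)"
proof -
  interpret C: module R "chain_module R K w n" by (rule chain_module_is_module)
  show ?thesis
    using assms
  proof (induction A rule: infinite_finite_induct)
    case (insert x F)
    then have "(\<lambda>a. f a \<tau>) \<in> F \<rightarrow> carrier R" "f x \<tau> \<in> carrier R" for \<tau>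
      by (auto simp: chain_carrier_iff Pi_iff)
    moreover have "f \<in> F \<rightarrow> carrier (chain_module R K w n)" "f x \<in> carrier (chain_module R K w n)"
      using insert.prems by auto
    ultimately show ?case
      using insert.hyps insert.IH by (simp add: C.finsum_insert finsum_insert)
  qed auto
qed

text \<open>Cancellation of the nonzero \<open>b\<close> in a domain supplies the uniqueness that
  \<open>THE\<close> requires.\<close>

lemma (in domain) exact_quotient_eqI:
  assumes "b \<in> carrier R" "b \<noteq> \<zero>" "c \<in> carrier R" "a = b \<otimes> c"
  shows "exact_quotient R a b = c"
  unfolding exact_quotient_def using assms m_lcancel by (intro the_equality) auto

lemma (in domain) exact_quotient:
  assumes "b \<in> carrier R" "b \<noteq> \<zero>" "b divides a"
  shows "exact_quotient R a b \<in> carrier R" "a = b \<otimes> exact_quotient R a b"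
proof -
  obtain c where "c \<in> carrier R" "a = b \<otimes> c"
    using assms(3) by (auto simp: factor_def)
  with exact_quotient_eqI[OF assms(1,2) this]
  show "exact_quotient R a b \<in> carrier R" "a = b \<otimes> exact_quotient R a b" by auto
qed

text \<open>Expresses the exponent of the sign of the \<open>i\<close>-th face through the removed
  vertex alone: in the strictly sorted list, the vertices below entry \<open>i\<close> are those at
  positions below \<open>i\<close>.\<close>

lemma card_less_sorted_list_of_set_nth:
  assumes "finite S" "i < card S"
  shows "card {u \<in> S. u < sorted_list_of_set S ! i} = i"
proof -
  let ?xs = "sorted_list_of_set S"
  have len: "length ?xs = card S" by simp
  have less: "?xs ! j < ?xs ! k \<longleftrightarrow> j < k" if "j < card S" "k < card S" for j k
    using that strict_sorted_list_of_set[of S] len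
    by (metis linorder_neqE_nat order_less_asym sorted_wrt_nth_less less_irrefl)
  have "{u \<in> S. u < ?xs ! i} = (!) ?xs ` {..<i}"
  proof
    show "{u \<in> S. u < ?xs ! i} \<subseteq> (!) ?xs ` {..<i}"
    proof
      fix u assume u: "u \<in> {u \<in> S. u < ?xs ! i}"
      then obtain j where "j < card S" "u = ?xs ! j"
        using assms len by (metis (lifting) in_set_conv_nth mem_Collect_eq set_sorted_list_of_set)
      then show "u \<in> (!) ?xs ` {..<i}" using u less assms by auto
    qed
    show "(!) ?xs ` {..<i} \<subseteq> {u \<in> S. u < ?xs ! i}"
      using assms less len nth_mem[of _ ?xs] by fastforce
  qed
  moreover have "inj_on ((!) ?xs) {..<i}"
    using assms by (intro inj_on_nth) auto
  ultimately show ?thesis by (simp add: card_image)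
qed

text \<open>
  Faces are indexed by the removed vertex instead of its position: the position of \<open>v\<close> in \<open>\<sigma>\<close> is
  the number of smaller vertices. Only meaningful when \<open>\<sigma> - {v}\<close> is nonempty.
\<close>

definition incidence :: "('r, 'c) ring_scheme \<Rightarrow> ('a::linorder set \<Rightarrow> 'r) \<Rightarrow> 'a set \<Rightarrow> 'a \<Rightarrow> 'r"
  where "incidence R w \<sigma> v =
    exact_quotient R (w \<sigma>) (w (\<sigma> - {v})) \<otimes>\<^bsub>R\<^esub> (\<ominus>\<^bsub>R\<^esub> \<one>\<^bsub>R\<^esub>) [^]\<^bsub>R\<^esub> card {u \<in> \<sigma>. u < v}"

text \<open>Removing the larger vertex \<open>v\<close> leaves the number of vertices below
  \<open>u\<close> unchanged, while removing \<open>u\<close> lowers the number below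
  \<open>v\<close> by one. The two orders of removal therefore differ by a single factor -1.\<close>

lemma (in cring) vertex_sign_antisymmetric:
  fixes \<sigma> :: "'v::linorder set"
  assumes "finite \<sigma>" "u \<in> \<sigma>" "v \<in> \<sigma>" "u < v"
  shows "(\<ominus> \<one>) [^] card {x \<in> \<sigma>. x < v} \<otimes> (\<ominus> \<one>) [^] card {x \<in> \<sigma> - {v}. x < u} =
    \<ominus> ((\<ominus> \<one>) [^] card {x \<in> \<sigma>. x < u} \<otimes> (\<ominus> \<one>) [^] card {x \<in> \<sigma> - {u}. x < v})"
proof -
  have "{x \<in> \<sigma> - {v}. x < u} = {x \<in> \<sigma>. x < u}"
    using assms by auto
  moreover have "{x \<in> \<sigma>. x < v} = insert u {x \<in> \<sigma> - {u}. x < v}"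
    using assms by auto
  then have "card {x \<in> \<sigma>. x < v} = Suc (card {x \<in> \<sigma> - {u}. x < v})"
    using assms by simp
  ultimately show ?thesis
    by (simp add: m_comm l_minus r_minus)
qed

section \<open>The weighted boundary map and the vanishing of its square\<close>

locale weighted_complex = domain R for R :: "('r, 'c) ring_scheme" (structure) +
  fixes K :: "'a::linorder set set" and w :: "'a set \<Rightarrow> 'r"
  assumes wsc: "weighted_simplicial_complex R K w"
begin

abbreviation "C \<equiv> chain_module R K w"
abbreviation "S \<equiv> weighted_simplices R K w"
abbreviation "d \<equiv> weighted_boundary R K w"

lemma module_C: "module R (C k)"
  by (rule chain_module_is_module)

sublocale C: module R "C k" for k
  by (rule module_C)

lemma finite_S: "finite (S k)"
  using wsc by (auto simp: weighted_simplicial_complex_def finite_simplicial_complex_def weighted_simplices_def)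

lemma w_closed: "\<sigma> \<in> K \<Longrightarrow> w \<sigma> \<in> carrier R"
  using wsc by (auto simp: weighted_simplicial_complex_def)

lemma face_in_K: "\<lbrakk>\<sigma> \<in> K; \<tau> \<subseteq> \<sigma>; \<tau> \<noteq> {}\<rbrakk> \<Longrightarrow> \<tau> \<in> K"
  using wsc unfolding weighted_simplicial_complex_def finite_simplicial_complex_def by blast

lemma weight_divides: "\<lbrakk>\<sigma> \<in> K; \<tau> \<in> K; \<tau> \<subseteq> \<sigma>\<rbrakk> \<Longrightarrow> w \<tau> divides w \<sigma>"
  using wsc unfolding weighted_simplicial_complex_def by blast

lemma S_D:
  assumes "\<sigma> \<in> S k"
  shows "finite \<sigma>" "int (card \<sigma>) = k + 1" "w \<sigma> \<in> carrier R" "w \<sigma> \<noteq> \<zero>" "\<sigma> \<in> K"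
  using assms wsc w_closed
  by (auto simp: weighted_simplicial_complex_def finite_simplicial_complex_def weighted_simplices_def
      simplex_dim_def)

lemma basis_chain_closed: "\<sigma> \<in> S k \<Longrightarrow> basis_chain R \<sigma> \<in> carrier (C k)"
  by (auto simp: basis_chain_def chain_carrier_iff)

text \<open>For \<open>k \<ge> 1\<close> the face is nonempty and so lies in \<open>K\<close>; its
  weight divides a nonzero weight and so is nonzero. Hence every term of the boundary formula is a
  multiple of a basis element.\<close>

lemma face_in_S:
  assumes "\<sigma> \<in> S k" "v \<in> \<sigma>" "k \<ge> 1"
  shows "\<sigma> - {v} \<in> S (k - 1)" "w (\<sigma> - {v}) divides w \<sigma>"
proof -
  note \<sigma> = S_D[OF assms(1)]
  have card: "card (\<sigma> - {v}) = card \<sigma> - 1" "card \<sigma> \<ge> 2"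
    using \<sigma> assms by auto
  then have "card (\<sigma> - {v}) \<noteq> 0" by linarith
  then have "\<sigma> - {v} \<noteq> {}" by (metis card.empty)
  then have K: "\<sigma> - {v} \<in> K"
    using face_in_K[OF \<sigma>(5)] by simp
  then show div: "w (\<sigma> - {v}) divides w \<sigma>"
    using weight_divides[OF \<sigma>(5)] by simp
  have "w (\<sigma> - {v}) \<noteq> \<zero>"
    using div \<sigma>(4) by (auto simp: factor_def)
  then show "\<sigma> - {v} \<in> S (k - 1)"
    using K card \<sigma> by (auto simp: weighted_simplices_def simplex_dim_def)
qed

lemma incidence_closed:
  assumes "\<sigma> \<in> S k" "v \<in> \<sigma>" "k \<ge> 1"
  shows "incidence R w \<sigma> v \<in> carrier R"
  unfolding incidence_def
  using exact_quotient(1)[of "w (\<sigma> - {v})" "w \<sigma>"] face_in_S[OF assms] S_D by auto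

text \<open>Reindexing along the bijection from positions to vertices given by the sorted list. Sums
  over vertices are easier to iterate, since positions shift when a vertex is removed.\<close>

lemma boundary_simplex_eq:
  assumes \<sigma>: "\<sigma> \<in> S k" and k: "k \<ge> 1"
  shows "weighted_boundary_simplex R K w k \<sigma> =
    (\<Oplus>\<^bsub>C (k - 1)\<^esub>v\<in>\<sigma>. incidence R w \<sigma> v \<odot>\<^bsub>C (k - 1)\<^esub> basis_chain R (\<sigma> - {v}))"
proof -
  let ?xs = "sorted_list_of_set \<sigma>"
  note \<sigma>D = S_D[OF \<sigma>]
  have card: "card \<sigma> = Suc (nat k)" using \<sigma>D(2) k by linarith
  have bij: "bij_betw ((!) ?xs) {0..nat k} \<sigma>"
    by (rule bij_betw_nth) (use \<sigma>D(1) card in auto)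
  have nth: "?xs ! i \<in> \<sigma>" if "i \<in> {0..nat k}" for i
    using bij that by (auto simp: bij_betw_def)
  have "weighted_boundary_simplex R K w k \<sigma> =
    (\<Oplus>\<^bsub>C (k - 1)\<^esub>i\<in>{0..nat k}. incidence R w \<sigma> (?xs ! i) \<odot>\<^bsub>C (k - 1)\<^esub> basis_chain R (\<sigma> - {?xs ! i}))"
    unfolding weighted_boundary_simplex_def
  proof (rule C.finsum_cong')
    show "(\<lambda>i. incidence R w \<sigma> (?xs ! i) \<odot>\<^bsub>C (k - 1)\<^esub> basis_chain R (\<sigma> - {?xs ! i}))
        \<in> {0..nat k} \<rightarrow> carrier (C (k - 1))"
      using face_in_S(1)[OF \<sigma> nth k] incidence_closed[OF \<sigma> nth k]
      by (intro funcsetI C.smult_closed basis_chain_closed)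
  next
    fix i assume "i \<in> {0..nat k}"
    then have "card {u \<in> \<sigma>. u < ?xs ! i} = i"
      using card_less_sorted_list_of_set_nth[OF \<sigma>D(1), of i] card by simp
    then show "(exact_quotient R (w \<sigma>) (w (simplex_face i \<sigma>)) \<otimes> (\<ominus> \<one>) [^] i)
        \<odot>\<^bsub>C (k - 1)\<^esub> basis_chain R (simplex_face i \<sigma>) =
        incidence R w \<sigma> (?xs ! i) \<odot>\<^bsub>C (k - 1)\<^esub> basis_chain R (\<sigma> - {?xs ! i})"
      by (simp add: incidence_def simplex_face_def)
  qed simp
  also have "\<dots> = (\<Oplus>\<^bsub>C (k - 1)\<^esub>v\<in>(!) ?xs ` {0..nat k}.
      incidence R w \<sigma> v \<odot>\<^bsub>C (k - 1)\<^esub> basis_chain R (\<sigma> - {v}))"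
    using bij face_in_S[OF \<sigma> _ k] incidence_closed[OF \<sigma> _ k]
    by (intro C.finsum_reindex[symmetric] funcsetI C.smult_closed basis_chain_closed)
      (auto simp: bij_betw_def)
  also have "(!) ?xs ` {0..nat k} = \<sigma>"
    using bij by (simp add: bij_betw_def)
  finally show ?thesis .
qed

lemma boundary_simplex_closed:
  assumes "\<sigma> \<in> S k" "k \<ge> 1"
  shows "weighted_boundary_simplex R K w k \<sigma> \<in> carrier (C (k - 1))"
  unfolding boundary_simplex_eq[OF assms]
  using face_in_S incidence_closed assms
  by (intro C.finsum_closed funcsetI C.smult_closed basis_chain_closed) auto

lemma chain_coeff: "c \<in> carrier (C k) \<Longrightarrow> c \<sigma> \<in> carrier R"
  by (simp add: chain_carrier_iff)

lemma boundary_hom: "d k \<in> module_hom_set R (C k) (C (k - 1))"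
proof (cases "k \<le> 0")
  case True
  then have "d k = (\<lambda>c. \<zero>\<^bsub>C (k - 1)\<^esub>)"
    by (simp add: weighted_boundary_def fun_eq_iff)
  then show ?thesis
    unfolding module_hom_set_def by (auto simp del: chain_module_sel)
next
  case False
  let ?b = "weighted_boundary_simplex R K w k"
  have b: "?b \<sigma> \<in> carrier (C (k - 1))" if "\<sigma> \<in> S k" for \<sigma>
    using boundary_simplex_closed that False by auto
  have d: "d k c = (\<Oplus>\<^bsub>C (k - 1)\<^esub>\<sigma>\<in>S k. c \<sigma> \<odot>\<^bsub>C (k - 1)\<^esub> ?b \<sigma>)" for c
    using False by (simp add: weighted_boundary_def)
  have closed: "(\<lambda>\<sigma>. c \<sigma> \<odot>\<^bsub>C (k - 1)\<^esub> ?b \<sigma>) \<in> S k \<rightarrow> carrier (C (k - 1))" if "c \<in> carrier (C k)" for c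
    using b chain_coeff[OF that] by (intro funcsetI C.smult_closed)
  show ?thesis
    unfolding module_hom_set_def
  proof (intro CollectI conjI ballI funcsetI)
    fix c assume c: "c \<in> carrier (C k)"
    show "d k c \<in> carrier (C (k - 1))"
      unfolding d by (rule C.finsum_closed[OF closed[OF c]])
    fix c' assume c': "c' \<in> carrier (C k)"
    have "d k (c \<oplus>\<^bsub>C k\<^esub> c') =
        (\<Oplus>\<^bsub>C (k - 1)\<^esub>\<sigma>\<in>S k. c \<sigma> \<odot>\<^bsub>C (k - 1)\<^esub> ?b \<sigma> \<oplus>\<^bsub>C (k - 1)\<^esub> c' \<sigma> \<odot>\<^bsub>C (k - 1)\<^esub> ?b \<sigma>)"
      unfolding d chain_module_sel(2)[of R K w k]
      using closed[OF c] closed[OF c']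
      by (intro C.finsum_cong' funcsetI C.smult_l_distr C.a_closed
          C.smult_closed b chain_coeff[OF c] chain_coeff[OF c'] refl)
    also have "\<dots> = d k c \<oplus>\<^bsub>C (k - 1)\<^esub> d k c'"
      unfolding d by (rule C.finsum_addf[OF closed[OF c] closed[OF c']])
    finally show "d k (c \<oplus>\<^bsub>C k\<^esub> c') = d k c \<oplus>\<^bsub>C (k - 1)\<^esub> d k c'" .
  next
    fix r c assume r: "r \<in> carrier R" and c: "c \<in> carrier (C k)"
    have "d k (r \<odot>\<^bsub>C k\<^esub> c) = (\<Oplus>\<^bsub>C (k - 1)\<^esub>\<sigma>\<in>S k. r \<odot>\<^bsub>C (k - 1)\<^esub> (c \<sigma> \<odot>\<^bsub>C (k - 1)\<^esub> ?b \<sigma>))"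
      unfolding d chain_module_sel(3)[of R K w k]
      by (intro C.finsum_cong' funcsetI C.smult_assoc1 C.smult_closed b refl r chain_coeff[OF c])
    also have "\<dots> = r \<odot>\<^bsub>C (k - 1)\<^esub> d k c"
      unfolding d by (rule C.finsum_smult_ldistr[OF finite_S r closed[OF c], symmetric])
    finally show "d k (r \<odot>\<^bsub>C k\<^esub> c) = r \<odot>\<^bsub>C (k - 1)\<^esub> d k c" .
  qed
qed

lemma boundary_basis_chain:
  assumes \<sigma>: "\<sigma> \<in> S k" and k: "k \<ge> 1"
  shows "d k (basis_chain R \<sigma>) = weighted_boundary_simplex R K w k \<sigma>"
proof -
  let ?b = "weighted_boundary_simplex R K w k"
  have b: "?b \<in> S k \<rightarrow> carrier (C (k - 1))"
    using boundary_simplex_closed k by auto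
  have "d k (basis_chain R \<sigma>) = (\<Oplus>\<^bsub>C (k - 1)\<^esub>\<tau>\<in>S k. basis_chain R \<sigma> \<tau> \<odot>\<^bsub>C (k - 1)\<^esub> ?b \<tau>)"
    using k by (simp add: weighted_boundary_def)
  also have "\<dots> = (\<Oplus>\<^bsub>C (k - 1)\<^esub>\<tau>\<in>S k. if \<sigma> = \<tau> then ?b \<tau> else \<zero>\<^bsub>C (k - 1)\<^esub>)"
    using b by (intro C.finsum_cong') (auto simp: basis_chain_def Pi_iff simp del: chain_module_sel)
  also have "\<dots> = ?b \<sigma>"
    by (rule C.finsum_singleton[OF \<sigma> finite_S b])
  finally show ?thesis .
qed

text \<open>The weight quotients telescope: w(\<sigma>)/w(\<sigma> - v) times w(\<sigma> -
  v)/w(\<sigma> - v - u) is w(\<sigma>)/w(\<sigma> - v - u), which is symmetric in \<open>u\<close>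
  and \<open>v\<close>. The order of removal is thus visible in the signs only, and these behave as
  in the unweighted case.\<close>

lemma incidence_product:
  assumes \<sigma>: "\<sigma> \<in> S (k + 1)" and "v \<in> \<sigma>" "u \<in> \<sigma>" "u \<noteq> v" "k \<ge> 1"
  shows "incidence R w \<sigma> v \<otimes> incidence R w (\<sigma> - {v}) u =
    exact_quotient R (w \<sigma>) (w (\<sigma> - {v} - {u})) \<otimes>
      ((\<ominus> \<one>) [^] card {x \<in> \<sigma>. x < v} \<otimes> (\<ominus> \<one>) [^] card {x \<in> \<sigma> - {v}. x < u})"
    and "exact_quotient R (w \<sigma>) (w (\<sigma> - {v} - {u})) \<in> carrier R"
proof -
  have 1: "\<sigma> - {v} \<in> S k" "w (\<sigma> - {v}) divides w \<sigma>"
    using face_in_S[OF \<sigma> \<open>v \<in> \<sigma>\<close>] \<open>k \<ge> 1\<close> by auto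
  then have 2: "\<sigma> - {v} - {u} \<in> S (k - 1)" "w (\<sigma> - {v} - {u}) divides w (\<sigma> - {v})"
    using face_in_S[of "\<sigma> - {v}" k u] assms by auto
  note c1 = S_D(3,4)[OF 1(1)] and c2 = S_D(3,4)[OF 2(1)]
  let ?p = "exact_quotient R (w \<sigma>) (w (\<sigma> - {v}))"
  let ?q = "exact_quotient R (w (\<sigma> - {v})) (w (\<sigma> - {v} - {u}))"
  note p = exact_quotient[OF c1 1(2)] and q = exact_quotient[OF c2 2(2)]
  have eq: "exact_quotient R (w \<sigma>) (w (\<sigma> - {v} - {u})) = ?p \<otimes> ?q"
  proof (rule exact_quotient_eqI[OF c2])
    have "w \<sigma> = (w (\<sigma> - {v} - {u}) \<otimes> ?q) \<otimes> ?p"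
      using p(2) q(2) by argo
    then show "w \<sigma> = w (\<sigma> - {v} - {u}) \<otimes> (?p \<otimes> ?q)"
      using c2 p(1) q(1) by (simp add: m_ac)
  qed (use p(1) q(1) in simp)
  then show "exact_quotient R (w \<sigma>) (w (\<sigma> - {v} - {u})) \<in> carrier R"
    using p q by simp
  show "incidence R w \<sigma> v \<otimes> incidence R w (\<sigma> - {v}) u =
    exact_quotient R (w \<sigma>) (w (\<sigma> - {v} - {u})) \<otimes>
      ((\<ominus> \<one>) [^] card {x \<in> \<sigma>. x < v} \<otimes> (\<ominus> \<one>) [^] card {x \<in> \<sigma> - {v}. x < u})"
    unfolding incidence_def eq using p(1) q(1) by (simp add: m_ac)
qed

lemma incidence_antisymmetric:
  assumes \<sigma>: "\<sigma> \<in> S (k + 1)" and "u \<in> \<sigma>" "v \<in> \<sigma>" "u \<noteq> v" "k \<ge> 1"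
  shows "incidence R w \<sigma> u \<otimes> incidence R w (\<sigma> - {u}) v \<oplus>
    incidence R w \<sigma> v \<otimes> incidence R w (\<sigma> - {v}) u = \<zero>"
proof -
  have comm: "\<sigma> - {u} - {v} = \<sigma> - {v} - {u}" by auto
  note q = incidence_product[OF \<sigma> \<open>v \<in> \<sigma>\<close> \<open>u \<in> \<sigma>\<close> \<open>u \<noteq> v\<close> \<open>k \<ge> 1\<close>]
    incidence_product[OF \<sigma> \<open>u \<in> \<sigma>\<close> \<open>v \<in> \<sigma>\<close> \<open>u \<noteq> v\<close>[symmetric] \<open>k \<ge> 1\<close>, unfolded comm]
  consider "u < v" | "v < u" using \<open>u \<noteq> v\<close> by fastforce
  then show ?thesis
  proof cases
    case 1
    show ?thesis
      unfolding q(1,3) vertex_sign_antisymmetric[OF S_D(1)[OF \<sigma>] \<open>u \<in> \<sigma>\<close> \<open>v \<in> \<sigma>\<close> 1]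
      using q(2) by (simp add: r_minus r_neg)
  next
    case 2
    show ?thesis
      unfolding q(1,3) vertex_sign_antisymmetric[OF S_D(1)[OF \<sigma>] \<open>v \<in> \<sigma>\<close> \<open>u \<in> \<sigma>\<close> 2]
      using q(2) by (simp add: r_minus l_neg)
  qed
qed

text \<open>Expanding twice gives a sum over ordered pairs of distinct vertices. Swapping the pair
  gives the same face with the opposite coefficient.\<close>

lemma boundary_boundary_simplex:
  assumes \<sigma>: "\<sigma> \<in> S (k + 1)" and k: "k \<ge> 1"
  shows "d k (weighted_boundary_simplex R K w (k + 1) \<sigma>) = \<zero>\<^bsub>C (k - 1)\<^esub>"
proof -
  have face: "\<sigma> - {v} \<in> S k" if "v \<in> \<sigma>" for v
    using face_in_S(1)[OF \<sigma> that] k by simp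
  have inc: "incidence R w \<sigma> v \<in> carrier R" if "v \<in> \<sigma>" for v
    using incidence_closed[OF \<sigma> that] k by simp
  have face2: "\<sigma> - {v} - {u} \<in> S (k - 1)" "incidence R w (\<sigma> - {v}) u \<in> carrier R"
    if "v \<in> \<sigma>" "u \<in> \<sigma> - {v}" for u v
    using face_in_S(1)[OF face that(2)] incidence_closed[OF face that(2)] that(1) k by auto
  let ?F = "\<lambda>v u. (incidence R w \<sigma> v \<otimes> incidence R w (\<sigma> - {v}) u) \<odot>\<^bsub>C (k - 1)\<^esub> basis_chain R (\<sigma> - {v} - {u})"
  have F: "?F v u \<in> carrier (C (k - 1))" if "v \<in> \<sigma>" "u \<in> \<sigma> - {v}" for u v
    using face2[OF that] inc[OF that(1)] by (intro C.smult_closed basis_chain_closed) auto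
  have "d k (weighted_boundary_simplex R K w (k + 1) \<sigma>) =
      d k (\<Oplus>\<^bsub>C k\<^esub>v\<in>\<sigma>. incidence R w \<sigma> v \<odot>\<^bsub>C k\<^esub> basis_chain R (\<sigma> - {v}))"
    using boundary_simplex_eq[OF \<sigma>] k by simp
  also have "\<dots> = (\<Oplus>\<^bsub>C (k - 1)\<^esub>v\<in>\<sigma>. d k (incidence R w \<sigma> v \<odot>\<^bsub>C k\<^esub> basis_chain R (\<sigma> - {v})))"
    by (intro module_hom_finsum[OF module_C module_C boundary_hom] funcsetI C.smult_closed
        basis_chain_closed inc face)
  also have "\<dots> = (\<Oplus>\<^bsub>C (k - 1)\<^esub>v\<in>\<sigma>. \<Oplus>\<^bsub>C (k - 1)\<^esub>u\<in>\<sigma> - {v}. ?F v u)"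
  proof (intro C.finsum_cong' funcsetI C.finsum_closed F refl)
    fix v assume v: "v \<in> \<sigma>"
    have "d k (incidence R w \<sigma> v \<odot>\<^bsub>C k\<^esub> basis_chain R (\<sigma> - {v})) =
        incidence R w \<sigma> v \<odot>\<^bsub>C (k - 1)\<^esub> weighted_boundary_simplex R K w k (\<sigma> - {v})"
      using module_hom_setD(3)[OF boundary_hom inc[OF v] basis_chain_closed[OF face[OF v]]]
        boundary_basis_chain[OF face[OF v] k] by simp
    also have "\<dots> = (\<Oplus>\<^bsub>C (k - 1)\<^esub>u\<in>\<sigma> - {v}. incidence R w \<sigma> v \<odot>\<^bsub>C (k - 1)\<^esub>
        (incidence R w (\<sigma> - {v}) u \<odot>\<^bsub>C (k - 1)\<^esub> basis_chain R (\<sigma> - {v} - {u})))"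
      unfolding boundary_simplex_eq[OF face[OF v] k]
      using S_D(1)[OF face[OF v]] inc[OF v] face2[OF v]
      by (intro C.finsum_smult_ldistr funcsetI C.smult_closed basis_chain_closed)
    also have "\<dots> = (\<Oplus>\<^bsub>C (k - 1)\<^esub>u\<in>\<sigma> - {v}. ?F v u)"
      by (intro C.finsum_cong' funcsetI F v refl C.smult_assoc1[symmetric] inc face2 basis_chain_closed)
    finally show "d k (incidence R w \<sigma> v \<odot>\<^bsub>C k\<^esub> basis_chain R (\<sigma> - {v})) =
        (\<Oplus>\<^bsub>C (k - 1)\<^esub>u\<in>\<sigma> - {v}. ?F v u)" .
  qed
  also have "\<dots> = \<zero>\<^bsub>C (k - 1)\<^esub>"
  proof (rule C.finsum_antisymmetric_offdiag)
    show "finite \<sigma>" by (rule S_D(1)[OF \<sigma>])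
    fix u v assume uv: "u \<in> \<sigma>" "v \<in> \<sigma>" "u \<noteq> v"
    show "?F u v \<in> carrier (C (k - 1))" using F uv by blast
    have comm: "\<sigma> - {v} - {u} = \<sigma> - {u} - {v}" by auto
    have b: "basis_chain R (\<sigma> - {u} - {v}) \<in> carrier (C (k - 1))"
      using uv by (intro basis_chain_closed face2) auto
    have "?F u v \<oplus>\<^bsub>C (k - 1)\<^esub> ?F v u =
        (incidence R w \<sigma> u \<otimes> incidence R w (\<sigma> - {u}) v \<oplus>
          incidence R w \<sigma> v \<otimes> incidence R w (\<sigma> - {v}) u) \<odot>\<^bsub>C (k - 1)\<^esub> basis_chain R (\<sigma> - {u} - {v})"
      unfolding comm using uv inc face2 b by (intro C.smult_l_distr[symmetric] m_closed) auto
    also have "\<dots> = \<zero>\<^bsub>C (k - 1)\<^esub>"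
      unfolding incidence_antisymmetric[OF \<sigma> uv k] by (rule C.smult_l_null[OF b])
    finally show "?F u v \<oplus>\<^bsub>C (k - 1)\<^esub> ?F v u = \<zero>\<^bsub>C (k - 1)\<^esub>" .
  qed
  finally show ?thesis .
qed

text \<open>Linearity reduces this to single simplices when \<open>k \<ge> 1\<close>; for smaller
  \<open>k\<close> the outer map is zero by definition.\<close>

theorem boundary_boundary:
  assumes c: "c \<in> carrier (C (k + 1))"
  shows "d k (d (k + 1) c) = \<zero>\<^bsub>C (k - 1)\<^esub>"
proof (cases "k \<ge> 1")
  case True
  let ?b = "weighted_boundary_simplex R K w (k + 1)"
  have b: "?b \<sigma> \<in> carrier (C k)" if "\<sigma> \<in> S (k + 1)" for \<sigma>
    using boundary_simplex_closed[OF that] True by simp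
  have "d k (d (k + 1) c) = d k (\<Oplus>\<^bsub>C k\<^esub>\<sigma>\<in>S (k + 1). c \<sigma> \<odot>\<^bsub>C k\<^esub> ?b \<sigma>)"
    using True by (simp add: weighted_boundary_def[of R K w "k + 1"])
  also have "\<dots> = (\<Oplus>\<^bsub>C (k - 1)\<^esub>\<sigma>\<in>S (k + 1). d k (c \<sigma> \<odot>\<^bsub>C k\<^esub> ?b \<sigma>))"
    by (intro module_hom_finsum[OF module_C module_C boundary_hom] funcsetI C.smult_closed b
        chain_coeff[OF c])
  also have "\<dots> = (\<Oplus>\<^bsub>C (k - 1)\<^esub>\<sigma>\<in>S (k + 1). \<zero>\<^bsub>C (k - 1)\<^esub>)"
  proof (intro C.finsum_cong' funcsetI refl C.zero_closed)
    fix \<sigma> assume \<sigma>: "\<sigma> \<in> S (k + 1)"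
    show "d k (c \<sigma> \<odot>\<^bsub>C k\<^esub> ?b \<sigma>) = \<zero>\<^bsub>C (k - 1)\<^esub>"
      unfolding module_hom_setD(3)[OF boundary_hom chain_coeff[OF c] b[OF \<sigma>]]
        boundary_boundary_simplex[OF \<sigma> True]
      by (rule C.smult_r_null[OF chain_coeff[OF c]])
  qed
  also have "\<dots> = \<zero>\<^bsub>C (k - 1)\<^esub>"
    by (rule C.finsum_zero)
  finally show ?thesis .
qed (simp add: weighted_boundary_def)

end

section \<open>Cycles, boundaries and subcomplexes\<close>

context weighted_complex
begin

abbreviation "Z \<equiv> cycle_module R K w"
abbreviation "B \<equiv> boundary_set R K w"
abbreviation "H \<equiv> weighted_homology R K w"

lemma cycle_carrier_iff: "c \<in> carrier (Z k) \<longleftrightarrow> c \<in> carrier (C k) \<and> d k c = \<zero>\<^bsub>C (k - 1)\<^esub>"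
  by (simp add: cycle_module_def a_kernel_def')

lemma cycle_module_sel [simp]:
  "zero (Z k) = zero (C k)" "add (Z k) = add (C k)" "smult (Z k) = smult (C k)"
  by (simp_all add: cycle_module_def)

lemma module_Z: "module R (Z k)"
  unfolding cycle_module_def
  by (rule submodule.submodule_is_module[OF module_hom_kernel_submodule module_C])
    (rule module_C module_C boundary_hom)+

text \<open>With the cycles as target, the boundaries are the image of a module homomorphism and
  hence a submodule of the cycles.\<close>

lemma boundary_hom_cycles: "d (k + 1) \<in> module_hom_set R (C (k + 1)) (Z k)"
  using boundary_hom[of "k + 1"]
  by (auto simp: module_hom_set_def cycle_carrier_iff Pi_iff boundary_boundary simp del: chain_module_sel)

lemma submodule_B: "submodule (B k) R (Z k)"
  unfolding boundary_set_def
  by (rule module_hom_image_submodule[OF module_C module_Z boundary_hom_cycles C.carrier_is_submodule])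

lemma module_H: "module R (H k)"
  unfolding weighted_homology_def
  by (rule module.quotient_module_is_module[OF module_Z submodule_B])

text \<open>In the form indexed by vertices, the coefficients and basis chains mention neither
  complex. The sums differ only in the module record, which pointwise evaluation eliminates.\<close>

lemma boundary_simplex_subcomplex:
  assumes L: "weighted_complex R L w" and \<rho>: "\<rho> \<in> weighted_simplices R L w k" "\<rho> \<in> S k" and k: "k \<ge> 1"
  shows "weighted_boundary_simplex R L w k \<rho> = weighted_boundary_simplex R K w k \<rho>"
proof -
  interpret L: weighted_complex R L w by fact
  have "(\<lambda>v. incidence R w \<rho> v \<odot>\<^bsub>C (k - 1)\<^esub> basis_chain R (\<rho> - {v})) \<in> \<rho> \<rightarrow> carrier (C (k - 1))"
    by (intro funcsetI C.smult_closed basis_chain_closed face_in_S(1)[OF \<rho>(2) _ k]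
        incidence_closed[OF \<rho>(2) _ k])
  moreover have "(\<lambda>v. incidence R w \<rho> v \<odot>\<^bsub>L.C (k - 1)\<^esub> basis_chain R (\<rho> - {v})) \<in> \<rho> \<rightarrow> carrier (L.C (k - 1))"
    by (intro funcsetI L.C.smult_closed L.basis_chain_closed L.face_in_S(1)[OF \<rho>(1) _ k]
        incidence_closed[OF \<rho>(2) _ k])
  ultimately show ?thesis
    unfolding boundary_simplex_eq[OF \<rho>(2) k] L.boundary_simplex_eq[OF \<rho>(1) k]
    by (simp add: finsum_chain_module)
qed

text \<open>Says that the inclusion of chains, the identity on functions, is a chain map. The
  simplices of \<open>K\<close> outside \<open>L\<close> contribute nothing because \<open>c\<close>
  vanishes on them.\<close>

lemma boundary_subcomplex:
  assumes L: "weighted_complex R L w" and "L \<subseteq> K" and c: "c \<in> carrier (chain_module R L w k)"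
  shows "weighted_boundary R L w k c = d k c"
proof (cases "k \<ge> 1")
  case True
  interpret L: weighted_complex R L w by fact
  have sub: "L.S k \<subseteq> S k"
    using \<open>L \<subseteq> K\<close> by (auto simp: weighted_simplices_def)
  have cK: "c \<in> carrier (C k)"
    using c sub by (auto simp: chain_carrier_iff)
  let ?b = "weighted_boundary_simplex R K w k"
  have K: "(\<lambda>\<rho>. c \<rho> \<odot>\<^bsub>C (k - 1)\<^esub> ?b \<rho>) \<in> S k \<rightarrow> carrier (C (k - 1))"
    by (intro funcsetI C.smult_closed boundary_simplex_closed chain_coeff[OF cK] True)
  have L': "(\<lambda>\<rho>. c \<rho> \<odot>\<^bsub>L.C (k - 1)\<^esub> weighted_boundary_simplex R L w k \<rho>) \<in> L.S k \<rightarrow> carrier (L.C (k - 1))"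
    by (intro funcsetI L.C.smult_closed L.boundary_simplex_closed chain_coeff[OF cK] True)
  have "weighted_boundary R L w k c =
      (\<Oplus>\<^bsub>L.C (k - 1)\<^esub>\<rho>\<in>L.S k. c \<rho> \<odot>\<^bsub>L.C (k - 1)\<^esub> weighted_boundary_simplex R L w k \<rho>)"
    using True by (simp add: weighted_boundary_def)
  also have "\<dots> = (\<lambda>\<tau>. \<Oplus>\<rho>\<in>L.S k. c \<rho> \<otimes> weighted_boundary_simplex R L w k \<rho> \<tau>)"
    unfolding finsum_chain_module[OF L'] by simp
  also have "\<dots> = (\<lambda>\<tau>. \<Oplus>\<rho>\<in>S k. c \<rho> \<otimes> ?b \<rho> \<tau>)"
  proof
    fix \<tau>
    have b: "?b \<rho> \<tau> \<in> carrier R" if "\<rho> \<in> S k" for \<rho>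
      by (rule chain_coeff[OF boundary_simplex_closed[OF that True]])
    show "(\<Oplus>\<rho>\<in>L.S k. c \<rho> \<otimes> weighted_boundary_simplex R L w k \<rho> \<tau>) = (\<Oplus>\<rho>\<in>S k. c \<rho> \<otimes> ?b \<rho> \<tau>)"
    proof (rule add.finprod_mono_neutral_cong_left[OF finite_S sub])
      show "c \<rho> \<otimes> ?b \<rho> \<tau> = \<zero>" if "\<rho> \<in> S k - L.S k" for \<rho>
        using that c b by (simp add: chain_carrier_iff)
      show "c \<rho> \<otimes> weighted_boundary_simplex R L w k \<rho> \<tau> = c \<rho> \<otimes> ?b \<rho> \<tau>" if "\<rho> \<in> L.S k" for \<rho>
        using boundary_simplex_subcomplex[OF L that _ True] sub that by auto
      show "(\<lambda>\<rho>. c \<rho> \<otimes> ?b \<rho> \<tau>) \<in> S k \<rightarrow> carrier R"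
        using b chain_coeff[OF cK] by auto
    qed
  qed
  also have "\<dots> = (\<Oplus>\<^bsub>C (k - 1)\<^esub>\<rho>\<in>S k. c \<rho> \<odot>\<^bsub>C (k - 1)\<^esub> ?b \<rho>)"
    unfolding finsum_chain_module[OF K] by simp
  also have "\<dots> = d k c"
    using True by (simp add: weighted_boundary_def)
  finally show ?thesis .
qed (simp add: weighted_boundary_def)

end

section \<open>The ring as a module over itself, and annihilators\<close>

lemma (in cring) ring_as_module_is_module: "module R (ring_as_module R)"
proof (rule moduleI)
  show "abelian_group (ring_as_module R)"
  proof (rule abelian_groupI)
    show "\<exists>y\<in>carrier (ring_as_module R).
        y \<oplus>\<^bsub>ring_as_module R\<^esub> x = \<zero>\<^bsub>ring_as_module R\<^esub>"
      if "x \<in> carrier (ring_as_module R)" for x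
      using that by (intro bexI[of _ "\<ominus> x"]) (auto simp: ring_as_module_def l_neg)
  qed (auto simp: ring_as_module_def a_assoc intro: a_comm)
qed (auto simp: ring_as_module_def l_distr r_distr m_assoc intro: cring_axioms)

text \<open>The annihilator is the kernel of the homomorphism from \<open>R\<close> to
  \<open>M\<close> that sends \<open>r\<close> to the multiple of \<open>x\<close> by
  \<open>r\<close>.\<close>

lemma (in module) annihilator_submodule:
  assumes "x \<in> carrier M"
  shows "submodule {r \<in> carrier R. r \<odot>\<^bsub>M\<^esub> x = \<zero>\<^bsub>M\<^esub>} R (ring_as_module R)"
proof -
  have "module R M" by unfold_locales
  moreover have "(\<lambda>r. r \<odot>\<^bsub>M\<^esub> x) \<in> module_hom_set R (ring_as_module R) M"
    using assms by (auto simp: module_hom_set_def ring_as_module_def smult_l_distr smult_assoc1)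
  moreover have "a_kernel (ring_as_module R) M (\<lambda>r. r \<odot>\<^bsub>M\<^esub> x) =
      {r \<in> carrier R. r \<odot>\<^bsub>M\<^esub> x = \<zero>\<^bsub>M\<^esub>}"
    by (simp add: a_kernel_def' ring_as_module_def)
  ultimately show ?thesis
    using module_hom_kernel_submodule[OF R.ring_as_module_is_module] by metis
qed

section \<open>Removing a maximal face\<close>

locale maximal_face_removal = weighted_complex R K w
  for R :: "('r, 'c) ring_scheme" (structure) and K :: "'a::linorder set set" and w :: "'a set \<Rightarrow> 'r" +
  fixes L :: "'a set set" and \<sigma> :: "'a set" and n :: int
  assumes maximal: "maximal_face K \<sigma>"
    and dim: "simplex_dim \<sigma> = n"
    and weight: "w \<sigma> \<noteq> \<zero>"
    and L_eq: "L = K - {\<sigma>}"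
begin

text \<open>Closure of \<open>L\<close> under faces is where maximality is essential: a simplex of
  \<open>L\<close> containing \<sigma> would properly contain it.\<close>

lemma weighted_complex_L: "weighted_complex R L w"
proof (intro weighted_complex.intro weighted_complex_axioms.intro domain_axioms)
  have "\<tau> \<in> L" if "\<rho> \<in> L" "\<tau> \<noteq> {}" "\<tau> \<subseteq> \<rho>" for \<rho> \<tau>
    using that face_in_K[of \<rho> \<tau>] maximal unfolding maximal_face_def L_eq by auto
  moreover have "finite L" "\<And>\<rho>. \<rho> \<in> L \<Longrightarrow> finite \<rho> \<and> \<rho> \<noteq> {}"
    using wsc by (auto simp: weighted_simplicial_complex_def finite_simplicial_complex_def L_eq)
  ultimately have "finite_simplicial_complex L"
    unfolding finite_simplicial_complex_def by blast
  moreover have "w \<in> L \<rightarrow> carrier R" "\<And>\<tau> \<rho>. \<tau> \<in> L \<Longrightarrow> \<rho> \<in> L \<Longrightarrow> \<tau> \<subseteq> \<rho> \<Longrightarrow> w \<tau> divides w \<rho>"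
    using w_closed weight_divides by (auto simp: L_eq)
  ultimately show "weighted_simplicial_complex R L w"
    unfolding weighted_simplicial_complex_def by blast
qed

sublocale L: weighted_complex R L w
  by (rule weighted_complex_L)

section \<open>Comparison of the two complexes degree by degree\<close>

lemma \<sigma>_in_S: "\<sigma> \<in> S n"
  using maximal dim weight by (auto simp: maximal_face_def weighted_simplices_def)

lemma simplices_L: "L.S k = S k - {\<sigma>}"
  by (auto simp: weighted_simplices_def L_eq)

lemma chain_module_L: "k \<noteq> n \<Longrightarrow> L.C k = C k"
proof -
  assume "k \<noteq> n"
  then have "L.S k = S k"
    unfolding simplices_L using dim by (auto simp: weighted_simplices_def)
  then show ?thesis by (simp add: chain_module_def)
qed

lemma chain_L_iff: "c \<in> carrier (L.C n) \<longleftrightarrow> c \<in> carrier (C n) \<and> c \<sigma> = \<zero>"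
  by (auto simp: chain_carrier_iff simplices_L)

lemma boundary_L: "c \<in> carrier (L.C k) \<Longrightarrow> L.d k c = d k c"
  by (rule boundary_subcomplex[OF weighted_complex_L]) (auto simp: L_eq)

text \<open>For \<open>k = n + 1\<close> the boundary maps have different target modules, but the
  zero of both is the same function, so the kernels still agree.\<close>

lemma cycle_module_L: "k \<noteq> n \<Longrightarrow> L.Z k = Z k"
  using boundary_L[of _ k] unfolding cycle_module_def a_kernel_def'
  by (auto simp: chain_module_L intro!: arg_cong[where f = "\<lambda>A. C k\<lparr>carrier := A\<rparr>"])

text \<open>The exceptional degree shifts to \<open>n - 1\<close> because boundaries in degree
  \<open>k\<close> come from chains in degree \<open>k + 1\<close>.\<close>

lemma boundary_set_L: "k \<noteq> n - 1 \<Longrightarrow> L.B k = B k"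
  using boundary_L[of _ "k + 1"] chain_module_L[of "k + 1"] unfolding boundary_set_def
  by (intro image_cong) auto

lemma chain_decomposition:
  assumes c: "c \<in> carrier (C n)"
  shows "c(\<sigma> := \<zero>) \<in> carrier (L.C n)"
    and "c = c(\<sigma> := \<zero>) \<oplus>\<^bsub>C n\<^esub> c \<sigma> \<odot>\<^bsub>C n\<^esub> basis_chain R \<sigma>"
  using c by (auto simp: chain_carrier_iff simplices_L basis_chain_def fun_eq_iff)

abbreviation "z \<equiv> d n (basis_chain R \<sigma>)"

text \<open>Linearity applied to the splitting of \<open>c\<close> into a chain of \<open>L\<close>
  and a multiple of \<sigma>. Since only linearity is used, \<open>n = 0\<close>, where all these
  boundaries vanish, needs no separate case.\<close>

lemma boundary_decomposition:
  assumes c: "c \<in> carrier (C n)"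
  shows "d n c = L.d n (c(\<sigma> := \<zero>)) \<oplus>\<^bsub>C (n - 1)\<^esub> c \<sigma> \<odot>\<^bsub>C (n - 1)\<^esub> z"
proof -
  let ?c' = "c(\<sigma> := \<zero>)"
  have c': "?c' \<in> carrier (C n)"
    using chain_decomposition(1)[OF c] chain_L_iff by blast
  have b: "basis_chain R \<sigma> \<in> carrier (C n)"
    by (rule basis_chain_closed[OF \<sigma>_in_S])
  have "d n c = d n (?c' \<oplus>\<^bsub>C n\<^esub> c \<sigma> \<odot>\<^bsub>C n\<^esub> basis_chain R \<sigma>)"
    using chain_decomposition(2)[OF c] by simp
  also have "\<dots> = d n ?c' \<oplus>\<^bsub>C (n - 1)\<^esub> c \<sigma> \<odot>\<^bsub>C (n - 1)\<^esub> z"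
    unfolding module_hom_setD(2)[OF boundary_hom c' C.smult_closed[OF chain_coeff[OF c] b]]
      module_hom_setD(3)[OF boundary_hom chain_coeff[OF c] b] ..
  also have "d n ?c' = L.d n ?c'"
    using boundary_L[OF chain_decomposition(1)[OF c]] by simp
  finally show ?thesis .
qed

text \<open>\<partial>\<sigma> lives in degree \<open>n - 1\<close>, where \<open>K\<close> and
  \<open>L\<close> have the same cycles; so it has a class in the homology of
  \<open>L\<close>.\<close>

lemma z_cycle: "z \<in> carrier (L.Z (n - 1))"
  using module_hom_setD(1)[OF boundary_hom_cycles[of "n - 1"], of "basis_chain R \<sigma>"]
    basis_chain_closed[OF \<sigma>_in_S] by (simp add: cycle_module_L)

lemma homology_class_smult:
  assumes "r \<in> carrier R"
  shows "r \<odot>\<^bsub>L.H (n - 1)\<^esub> homology_class R L w (n - 1) z = L.B (n - 1) +>\<^bsub>L.Z (n - 1)\<^esub> (r \<odot>\<^bsub>C (n - 1)\<^esub> z)"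
  using module.quotient_smult[OF L.module_Z L.submodule_B assms z_cycle]
  unfolding weighted_homology_def homology_class_def by simp

section \<open>The three homology statements\<close>

theorem homology_other_degrees:
  assumes "k \<notin> {n - 1, n}"
  shows "modules_isomorphic R (L.H k) (H k)"
  \<comment> \<open>The cycle modules agree as \<open>k \<noteq> n\<close> and the boundary sets as
    \<open>k \<noteq> n - 1\<close>, so the two homology modules are equal and reflexivity
    suffices.\<close>
  using modules_isomorphic_refl[OF module_H[of k]] assms
  by (simp add: weighted_homology_def cycle_module_L boundary_set_L)

lemma L_boundary_in_B: "c \<in> carrier (L.C n) \<Longrightarrow> L.d n c \<in> L.B (n - 1)"
  by (simp add: boundary_set_def)

theorem homology_below:
  "modules_isomorphic R (H (n - 1))
    (quotient_module (L.H (n - 1))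
      {r \<odot>\<^bsub>L.H (n - 1)\<^esub> homology_class R L w (n - 1) z | r. r \<in> carrier R})"
proof -
  let ?\<pi> = "\<lambda>x. L.B (n - 1) +>\<^bsub>L.Z (n - 1)\<^esub> x"
  interpret Z: module R "L.Z (n - 1)" by (rule L.module_Z)
  interpret BL: abelian_subgroup "L.B (n - 1)" "L.Z (n - 1)"
    by (rule Z.submodule_abelian_subgroup[OF L.submodule_B])
  have Z_eq: "L.Z (n - 1) = Z (n - 1)" by (rule cycle_module_L) simp
  have rz: "r \<odot>\<^bsub>C (n - 1)\<^esub> z \<in> carrier (L.Z (n - 1))" if "r \<in> carrier R" for r
    using Z.smult_closed[OF that z_cycle] by simp
  have "L.B (n - 1) \<subseteq> B (n - 1)"
    using boundary_L[of _ n] chain_L_iff unfolding boundary_set_def by auto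
  then have iso: "modules_isomorphic R (H (n - 1)) (quotient_module (L.H (n - 1)) (?\<pi> ` B (n - 1)))"
    using module_third_isomorphism[OF L.module_Z L.submodule_B, of "B (n - 1)" "n - 1"] submodule_B
    unfolding weighted_homology_def Z_eq by blast
  \<comment> \<open>A boundary \<open>d n c\<close> of \<open>K\<close> differs from
    \<open>c \<sigma>\<close> times \<open>z\<close> by a boundary of \<open>L\<close>, so its class
    is a multiple of that of \<open>z\<close>. Conversely, \<open>r\<close> times \<open>z\<close>
    is the boundary of \<open>r\<close> times \<sigma>.\<close>
  have "?\<pi> ` B (n - 1) = {?\<pi> (r \<odot>\<^bsub>C (n - 1)\<^esub> z) | r. r \<in> carrier R}" (is "?A = ?S")
  proof (intro equalityI subsetI)
    fix X assume "X \<in> ?A"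
    then obtain c where c: "c \<in> carrier (C n)" "X = ?\<pi> (d n c)"
      by (auto simp: boundary_set_def)
    have "d n c \<in> ?\<pi> (c \<sigma> \<odot>\<^bsub>C (n - 1)\<^esub> z)"
      using boundary_decomposition[OF c(1)] L_boundary_in_B[OF chain_decomposition(1)[OF c(1)]]
      by (auto simp: a_r_coset_def' chain_module_L)
    then have "X = ?\<pi> (c \<sigma> \<odot>\<^bsub>C (n - 1)\<^esub> z)"
      unfolding c(2) using BL.a_repr_independence'[OF _ rz[OF chain_coeff[OF c(1)]]] by simp
    then show "X \<in> ?S" using chain_coeff[OF c(1)] by blast
  next
    fix X assume "X \<in> ?S"
    then obtain r where r: "r \<in> carrier R" "X = ?\<pi> (r \<odot>\<^bsub>C (n - 1)\<^esub> z)" by blast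
    have b: "basis_chain R \<sigma> \<in> carrier (C n)"
      by (rule basis_chain_closed[OF \<sigma>_in_S])
    have "r \<odot>\<^bsub>C (n - 1)\<^esub> z = d n (r \<odot>\<^bsub>C n\<^esub> basis_chain R \<sigma>)"
      by (rule module_hom_setD(3)[OF boundary_hom r(1) b, symmetric])
    also have "\<dots> \<in> B (n - 1)"
      using C.smult_closed[OF r(1) b] unfolding boundary_set_def by (simp del: chain_module_sel)
    finally show "X \<in> ?A" using r(2) by blast
  qed
  also have "\<dots> = {r \<odot>\<^bsub>L.H (n - 1)\<^esub> homology_class R L w (n - 1) z | r. r \<in> carrier R}"
    using homology_class_smult by (metis (no_types, lifting))
  finally show ?thesis using iso by simp
qed

text \<open>Both complexes have the same boundaries in degree \<open>n\<close>, so a homology class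
  of \<open>L\<close> is, as a set, already a class of \<open>K\<close>. This puts the image of
  \<open>i_*\<close> into the form P/B of the third isomorphism theorem, with P the cycles of
  \<open>L\<close>.\<close>

lemma induced_map_image:
  "induced_homology_map R K w n id ` carrier (L.H n) = (\<lambda>x. B n +>\<^bsub>Z n\<^esub> x) ` carrier (L.Z n)"
proof -
  interpret Z: module R "Z n" by (rule module_Z)
  interpret ZL: module R "L.Z n" by (rule L.module_Z)
  interpret BK: abelian_subgroup "B n" "Z n"
    by (rule Z.submodule_abelian_subgroup[OF submodule_B])
  interpret BL: abelian_subgroup "L.B n" "L.Z n"
    by (rule ZL.submodule_abelian_subgroup[OF L.submodule_B])
  have B_eq: "L.B n = B n" by (rule boundary_set_L) simp
  have "induced_homology_map R K w n id (L.B n +>\<^bsub>L.Z n\<^esub> x) = B n +>\<^bsub>Z n\<^esub> x"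
    if x: "x \<in> carrier (L.Z n)" for x
  proof -
    have xZ: "x \<in> carrier (Z n)"
      using x boundary_L[of x n] chain_L_iff[of x]
      by (simp add: cycle_carrier_iff L.cycle_carrier_iff)
    have coset: "L.B n +>\<^bsub>L.Z n\<^esub> x = B n +>\<^bsub>Z n\<^esub> x"
      by (simp add: a_r_coset_def' B_eq)
    have "B n +>\<^bsub>Z n\<^esub> y = B n +>\<^bsub>Z n\<^esub> x" if "y \<in> B n +>\<^bsub>Z n\<^esub> x" for y
      using BK.a_repr_independence'[OF that xZ] by simp
    then show ?thesis
      using BK.a_rcos_self[OF xZ]
      unfolding induced_homology_map_def homology_class_def coset id_apply by blast
  qed
  then show ?thesis
    unfolding weighted_homology_def ZL.quotient_carrier[OF L.submodule_B]
    by (simp add: image_image cong: image_cong)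
qed

theorem homology_top:
  "modules_isomorphic R
    (quotient_module (H n) (induced_homology_map R K w n id ` carrier (L.H n)))
    ((ring_as_module R)\<lparr>carrier :=
      {r \<in> carrier R. r \<odot>\<^bsub>L.H (n - 1)\<^esub> homology_class R L w (n - 1) z = \<zero>\<^bsub>L.H (n - 1)\<^esub>}\<rparr>)"
proof -
  let ?I = "{r \<in> carrier R. r \<odot>\<^bsub>L.H (n - 1)\<^esub> homology_class R L w (n - 1) z = \<zero>\<^bsub>L.H (n - 1)\<^esub>}"
  let ?M = "(ring_as_module R)\<lparr>carrier := ?I\<rparr>"
  interpret ZL: module R "L.Z (n - 1)" by (rule L.module_Z)
  interpret HL: module R "L.H (n - 1)" by (rule L.module_H)
  have "homology_class R L w (n - 1) z \<in> carrier (L.H (n - 1))"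
    unfolding homology_class_def weighted_homology_def
    by (rule ZL.coset_in_quotient[OF L.submodule_B z_cycle])
  then have M: "module R ?M"
    by (intro submodule.submodule_is_module[OF HL.annihilator_submodule] ring_as_module_is_module)
  \<comment> \<open>Vanishing of a multiple of the class is translated to the chain level: the
    multiple of \<open>z\<close> bounds in \<open>L\<close>.\<close>
  have I_iff: "r \<in> ?I \<longleftrightarrow> r \<odot>\<^bsub>C (n - 1)\<^esub> z \<in> L.B (n - 1)" if "r \<in> carrier R" for r
  proof -
    have "r \<odot>\<^bsub>C (n - 1)\<^esub> z \<in> carrier (L.Z (n - 1))"
      using ZL.smult_closed[OF that z_cycle] by simp
    from ZL.coset_eq_self_iff[OF L.submodule_B this] show ?thesis
      using homology_class_smult[OF that] that
      by (simp add: weighted_homology_def quotient_module_sel)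
  qed
  have zC: "z \<in> carrier (C (n - 1))"
    by (rule module_hom_setD(1)[OF boundary_hom basis_chain_closed[OF \<sigma>_in_S]])
  have dL: "L.d n c \<in> carrier (C (n - 1))" if "c \<in> carrier (L.C n)" for c
    using module_hom_setD(1)[OF L.boundary_hom that] chain_module_L[of "n - 1"] by simp
  have BL: "submodule (L.B (n - 1)) R (L.Z (n - 1))" by (rule L.submodule_B)
  let ?ev = "\<lambda>c. c \<sigma>"
  \<comment> \<open>If \<open>c\<close> is a cycle, \<open>boundary_decomposition\<close> makes
    \<open>c \<sigma>\<close> times \<open>z\<close> the negative of a boundary of
    \<open>L\<close>.\<close>
  have ev: "c \<sigma> \<in> ?I" if "c \<in> carrier (Z n)" for c
  proof -
    have c: "c \<in> carrier (C n)" "d n c = \<zero>\<^bsub>C (n - 1)\<^esub>"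
      using that by (simp_all add: cycle_carrier_iff del: chain_module_sel)
    let ?c' = "c(\<sigma> := \<zero>)"
    note c' = chain_decomposition(1)[OF c(1)]
    have r: "c \<sigma> \<in> carrier R" by (rule chain_coeff[OF c(1)])
    have "L.d n ?c' \<oplus>\<^bsub>C (n - 1)\<^esub> c \<sigma> \<odot>\<^bsub>C (n - 1)\<^esub> z = \<zero>\<^bsub>C (n - 1)\<^esub>"
      using boundary_decomposition[OF c(1)] c(2) by argo
    then have "\<ominus>\<^bsub>C (n - 1)\<^esub> L.d n ?c' = c \<sigma> \<odot>\<^bsub>C (n - 1)\<^esub> z"
      using dL[OF c'] C.smult_closed[OF r zC] C.minus_equality C.a_comm by metis
    \<comment> \<open>The negative is written as a multiple by \<open>\<ominus> \<one>\<close>, so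
      that closure of the boundaries under scalars applies.\<close>
    then have "c \<sigma> \<odot>\<^bsub>C (n - 1)\<^esub> z = (\<ominus> \<one>) \<odot>\<^bsub>C (n - 1)\<^esub> L.d n ?c'"
      using C.smult_l_minus[OF one_closed dL[OF c']] C.smult_one[OF dL[OF c']] by argo
    moreover have "(\<ominus> \<one>) \<odot>\<^bsub>C (n - 1)\<^esub> L.d n ?c' \<in> L.B (n - 1)"
      using submodule.smult_closed[OF BL _ L_boundary_in_B[OF c'], of "\<ominus> \<one>"] by simp
    ultimately show ?thesis
      using I_iff[OF r] by simp
  qed
  have hom: "?ev \<in> module_hom_set R (Z n) ?M"
    unfolding module_hom_set_def using ev by (auto simp: ring_as_module_def)
  have onto: "?ev ` carrier (Z n) = carrier ?M"
  proof (intro equalityI subsetI)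
    fix r assume "r \<in> carrier ?M"
    then have r: "r \<in> carrier R" "r \<odot>\<^bsub>C (n - 1)\<^esub> z \<in> L.B (n - 1)"
      using I_iff by auto
    then obtain e where e: "e \<in> carrier (L.C n)" "r \<odot>\<^bsub>C (n - 1)\<^esub> z = L.d n e"
      by (auto simp: boundary_set_def)
    \<comment> \<open>If \<open>e\<close> in \<open>L\<close> bounds \<open>r\<close> times
      \<open>z\<close>, then \<open>r\<close> times \<sigma> minus \<open>e\<close> is a cycle of
      \<open>K\<close>. Its value at \<sigma> is \<open>r\<close> because \<open>e\<close> vanishes
      there.\<close>
    define c where "c = r \<odot>\<^bsub>C n\<^esub> basis_chain R \<sigma> \<oplus>\<^bsub>C n\<^esub> (\<ominus> \<one>) \<odot>\<^bsub>C n\<^esub> e"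
    have b: "basis_chain R \<sigma> \<in> carrier (C n)" by (rule basis_chain_closed[OF \<sigma>_in_S])
    have eC: "e \<in> carrier (C n)" and e\<sigma>: "e \<sigma> = \<zero>" using e(1) chain_L_iff by auto
    have c: "c \<in> carrier (C n)"
      unfolding c_def by (intro C.a_closed C.smult_closed r b eC) simp
    have "d n c = r \<odot>\<^bsub>C (n - 1)\<^esub> z \<oplus>\<^bsub>C (n - 1)\<^esub> (\<ominus> \<one>) \<odot>\<^bsub>C (n - 1)\<^esub> d n e"
      unfolding c_def
      using module_hom_setD[OF boundary_hom[of n]] C.smult_closed[OF r(1) b] C.smult_closed[OF _ eC, of "\<ominus> \<one>"] r b eC
      by (simp del: chain_module_sel)
    also have "d n e = r \<odot>\<^bsub>C (n - 1)\<^esub> z" using boundary_L[OF e(1)] e(2) by simp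
    also have "r \<odot>\<^bsub>C (n - 1)\<^esub> z \<oplus>\<^bsub>C (n - 1)\<^esub> (\<ominus> \<one>) \<odot>\<^bsub>C (n - 1)\<^esub> (r \<odot>\<^bsub>C (n - 1)\<^esub> z) = \<zero>\<^bsub>C (n - 1)\<^esub>"
      using C.smult_l_minus[OF one_closed] C.smult_one C.r_neg C.smult_closed[OF r(1) zC] by metis
    finally have "c \<in> carrier (Z n)" using c by (simp add: cycle_carrier_iff)
    moreover have "c \<sigma> = r"
      using r(1) e\<sigma> by (simp add: c_def basis_chain_def)
    ultimately show "r \<in> ?ev ` carrier (Z n)" by blast
  qed (use ev in auto)
  \<comment> \<open>A cycle of \<open>K\<close> vanishing at \<sigma> is a chain of \<open>L\<close>
    with the same boundary, hence a cycle of \<open>L\<close>.\<close>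
  have ker: "a_kernel (Z n) ?M ?ev = carrier (L.Z n)"
    using chain_L_iff boundary_L[of _ n]
    by (auto simp: a_kernel_def' cycle_carrier_iff L.cycle_carrier_iff ring_as_module_def)
  have P: "submodule (carrier (L.Z n)) R (Z n)"
    using module_hom_kernel_submodule[OF module_Z M hom] ker by simp
  \<comment> \<open>In degree \<open>n\<close> the boundaries of \<open>K\<close> are those of
    \<open>L\<close>, so they are cycles of \<open>L\<close>, as the third isomorphism theorem
    requires.\<close>
  have "B n \<subseteq> carrier (L.Z n)"
    using module.submoduleE(1)[OF L.module_Z L.submodule_B[of n]] boundary_set_L[of n] by simp
  then have "modules_isomorphic R (quotient_module (Z n) (carrier (L.Z n)))
      (quotient_module (H n) (induced_homology_map R K w n id ` carrier (L.H n)))"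
    using module_third_isomorphism[OF module_Z submodule_B P]
    unfolding induced_map_image weighted_homology_def[of R K w n] by simp
  moreover have "modules_isomorphic R (quotient_module (Z n) (carrier (L.Z n))) ?M"
    using module_first_isomorphism[OF module_Z M hom onto] unfolding ker .
  ultimately show ?thesis
    using modules_isomorphic_sym modules_isomorphic_trans by blast
qed

end

theorem theorem3p12:
  fixes R :: "('r, 'c) ring_scheme" (structure)
    and K L :: "'a::linorder set set"
    and w :: "'a set \<Rightarrow> 'r"
    and \<sigma> :: "'a set"
    and n :: int
  assumes "domain R"
    and "weighted_simplicial_complex R K w"
    and "maximal_face K \<sigma>"
    and "simplex_dim \<sigma> = n"
    and "w \<sigma> \<noteq> \<zero>"
    and "L = K - {\<sigma>}"
  shows
    "(\<forall>k. k \<notin> {n - 1, n} \<longrightarrow>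
        modules_isomorphic R (weighted_homology R L w k) (weighted_homology R K w k)) \<and>
     modules_isomorphic R
       (weighted_homology R K w (n - 1))
       (quotient_module (weighted_homology R L w (n - 1))
         {r \<odot>\<^bsub>weighted_homology R L w (n - 1)\<^esub>
            homology_class R L w (n - 1) (weighted_boundary R K w n (basis_chain R \<sigma>))
          | r. r \<in> carrier R}) \<and>
     modules_isomorphic R
       (quotient_module (weighted_homology R K w n)
         (induced_homology_map R K w n id ` carrier (weighted_homology R L w n)))
       ((ring_as_module R)\<lparr>carrier :=
         {r \<in> carrier R.
           r \<odot>\<^bsub>weighted_homology R L w (n - 1)\<^esub>
             homology_class R L w (n - 1) (weighted_boundary R K w n (basis_chain R \<sigma>))
           = \<zero>\<^bsub>weighted_homology R L w (n - 1)\<^esub>}\<rparr>)"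
proof -
  interpret maximal_face_removal R K w L \<sigma> n
    by (intro maximal_face_removal.intro weighted_complex.intro weighted_complex_axioms.intro
        maximal_face_removal_axioms.intro assms)
  show ?thesis
    using homology_other_degrees homology_below homology_top by blast
qed

end
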